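(* Let $M$ be a completely regular MT-algebra with Stone–Čech extension $\beta M=\mathbf{RO}(X_{\mathcal Z(M)})$. Then $\mathcal O(\beta M)\cong\beta\,\mathcal O(M)$ as frames, where $\beta\,\mathcal O(M)$ is the frame of completely regular ideals of $\mathcal O(M)$.
   Context: MT-algebras. An MT-algebra is a pair $(M,\square)$, where $M$ is a complete Boolean algebra and $\square:M\to M$ satisfies $\square 1=1$, $\square(a\wedge b)=\square a\wedge\square b$, $\square a\le a$, $\square a\le\square\square a$. Put $\Diamond a=\neg\square\neg a$. An element $a$ is open if $a=\square a$ and closed if $a=\Diamond a$; $\mathcal O(M)$ (a frame) and $\mathcal C(M)$ are the sets of open and closed elements. $M$ is $T_1$ if every element is a join of closed elements. Complete regularity and zero-elements. Write $a\prec b$ if $\Diamond a\le\square b$, and $a\prec\!\prec b$ if there is a family $\{c_p\mid p\in[0,1]\cap\mathbb Q\}\subseteq M$ with $a\le c_0$, $c_1\le b$, and $c_p\prec c_q$ whenever $p<q$. (The family may be chosen to consist of open elements, and on $\mathcal O(M)$ the relation coincides with the usual completely-below relation of the frame $\mathcal O(M)$.) $M$ is completely regular if it is $T_1$ and $u=\bigvee\{v\in\mathcal O(M)\mid v\prec\!\prec u\}$ for each $u\in\mathcal O(M)$. An element $a\in M$ is a zero-element if there is a sequence $(c_n)_{n\in\mathbb N}$ in $\mathcal C(M)$ with $a=\bigwedge_n c_n$ and $c_{n+1}\prec\!\prec c_n$ for all $n$. $\mathcal Z(M)$ is the set of zero-elements, a bounded sublattice of $\mathcal C(M)$. The algebra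 $\mathbf{RO}(X_{\mathcal B})$. For a bounded sublattice $\mathcal B$ of $\mathcal C(M)$ (here $\mathcal B=\mathcal Z(M)$), $X_{\mathcal B}$ is the set of proper filters of $\mathcal B$ ordered by inclusion and given the topology of upsets. $\mathbf{RO}(X_{\mathcal B})$ is the complete Boolean algebra of regular open sets of $X_{\mathcal B}$, i.e. upsets $U$ with $U=\{x\mid \mathord{\uparrow}x\subseteq\mathord{\downarrow}U\}$. For $a\in M$, $$\sigma_{\mathcal B}(a)=\{x\in X_{\mathcal B}\mid \text{for all } y\in X_{\mathcal B}\text{ with }x\subseteq y\text{ and all }b\in y,\ a\wedge b\ne0\},$$ which is an element of $\mathbf{RO}(X_{\mathcal B})$. $\mathbf{RO}(X_{\mathcal B})$ is made an MT-algebra by declaring its closed elements to be the arbitrary meets of elements of $\{\sigma_{\mathcal B}(b)\mid b\in\mathcal B\}$ (the open elements are the complements of closed ones, and $\square A$ is the largest open element below $A$). Completely regular ideals. For a completely regular frame $L$, an ideal $I$ of $L$ is completely regular if for each $a\in I$ there is $b\in I$ with $a\prec\!\prec b$. $\beta L$ denotes the frame of completely regular ideals of $L$ ordered by inclusion. *)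

theory Defs
  imports Complex_Main "HOL-Algebra.Complete_Lattice"
begin

section \<open>MT-algebras\<close>

text \<open>
  A complete Boolean algebra is a type of sort \<open>{boolean_algebra, complete_lattice}\<close>. The class
  \<^class>\<open>complete_boolean_algebra\<close> is not used, since it includes the complete distributivity law
  and hence admits only atomic algebras.
\<close>

locale mt_algebra =
  fixes box :: "'a :: {boolean_algebra, complete_lattice} \<Rightarrow> 'a"
  assumes box_one: "box top_class.top = top_class.top"
    and box_meet: "box (inf a b) = inf (box a) (box b)"
    and box_le: "box a \<le> a"
    and box_le_box_box: "box a \<le> box (box a)"

context
  fixes box :: "'a :: {boolean_algebra, complete_lattice} \<Rightarrow> 'a"
begin

definition dia :: "'a \<Rightarrow> 'a" where
  "dia a = - box (- a)"

definition opens :: "'a set" where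
  "opens = {a. a = box a}"

definition closeds :: "'a set" where
  "closeds = {a. a = dia a}"

definition T1 :: bool where
  "T1 \<longleftrightarrow> (\<forall>a. \<exists>S \<subseteq> closeds. a = Sup S)"

definition well_below :: "'a \<Rightarrow> 'a \<Rightarrow> bool" where
  "well_below a b \<longleftrightarrow> dia a \<le> box b"

text \<open>Only the values of \<open>c\<close> on the rationals in \<open>[0, 1]\<close> matter.\<close>

definition completely_below :: "'a \<Rightarrow> 'a \<Rightarrow> bool" where
  "completely_below a b \<longleftrightarrow>
     (\<exists>c :: rat \<Rightarrow> 'a. a \<le> c 0 \<and> c 1 \<le> b \<and>
        (\<forall>p\<in>{0..1}. \<forall>q\<in>{0..1}. p < q \<longrightarrow> well_below (c p) (c q)))"

definition zero_elements :: "'a set" where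
  "zero_elements =
     {a. \<exists>c :: nat \<Rightarrow> 'a. (\<forall>n. c n \<in> closeds) \<and> a = (INF n. c n) \<and>
           (\<forall>n. completely_below (c (Suc n)) (c n))}"

definition open_frame :: "'a gorder" where
  "open_frame = \<lparr>carrier = opens, eq = (=), le = (\<le>)\<rparr>"

end

locale completely_regular_mt_algebra = mt_algebra box
  for box :: "'a :: {boolean_algebra, complete_lattice} \<Rightarrow> 'a" +
  assumes T1_box: "T1 box"
    and open_eq_Sup: "u \<in> opens box \<Longrightarrow> u = Sup {v \<in> opens box. completely_below box v u}"

section \<open>The algebra of regular open sets of filters\<close>

definition is_filter :: "'a :: lattice set \<Rightarrow> 'a set \<Rightarrow> bool" where
  "is_filter B F \<longleftrightarrow>
     F \<subseteq> B \<and> F \<noteq> {} \<and> (\<forall>a\<in>F. \<forall>b\<in>F. inf a b \<in> F) \<and> (\<forall>a\<in>F. \<forall>b\<in>B. a \<le> b \<longrightarrow> b \<in> F)"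

definition proper_filters :: "'a :: lattice set \<Rightarrow> 'a set set" where
  "proper_filters B = {F. is_filter B F \<and> F \<noteq> B}"

definition upset :: "'p :: order set \<Rightarrow> 'p set \<Rightarrow> bool" where
  "upset X U \<longleftrightarrow> U \<subseteq> X \<and> (\<forall>x\<in>U. \<forall>y\<in>X. x \<le> y \<longrightarrow> y \<in> U)"

text \<open>
  In the topology of upsets the closure of \<open>U\<close> is the downset of \<open>U\<close>, and the interior of a set
  \<open>A\<close> consists of the points \<open>x\<close> with \<open>\<up>x \<subseteq> A\<close>.
\<close>

definition regular_open_algebra :: "'p :: order set \<Rightarrow> 'p set gorder" where
  "regular_open_algebra X =
     \<lparr>carrier = {U. upset X U \<and> U = {x \<in> X. \<forall>y\<in>X. x \<le> y \<longrightarrow> (\<exists>z\<in>U. y \<le> z)}},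
      eq = (=), le = (\<subseteq>)\<rparr>"

definition sigma :: "'a :: bounded_lattice set \<Rightarrow> 'a \<Rightarrow> 'a set set" where
  "sigma B a =
     {x \<in> proper_filters B. \<forall>y \<in> proper_filters B. x \<subseteq> y \<longrightarrow> (\<forall>b\<in>y. inf a b \<noteq> bot)}"

text \<open>
  The MT-algebra structure on the regular open sets is given by its closed elements, namely the meets
  (in the algebra, including the empty meet) of sets of elements \<^term>\<open>sigma B b\<close> with \<open>b\<close> in \<open>B\<close>;
  the open elements are their complements in the algebra.
\<close>

definition extension_closeds :: "'a :: bounded_lattice set \<Rightarrow> 'a set set set" where
  "extension_closeds B =
     {\<Sqinter>\<^bsub>regular_open_algebra (proper_filters B)\<^esub> S | S. S \<subseteq> sigma B ` B}"

definition is_complement :: "('a, 'c) gorder_scheme \<Rightarrow> 'a \<Rightarrow> 'a \<Rightarrow> bool" where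
  "is_complement L a b \<longleftrightarrow>
     a \<in> carrier L \<and> b \<in> carrier L \<and> a \<sqinter>\<^bsub>L\<^esub> b = \<bottom>\<^bsub>L\<^esub> \<and> a \<squnion>\<^bsub>L\<^esub> b = \<top>\<^bsub>L\<^esub>"

definition extension_opens :: "'a :: bounded_lattice set \<Rightarrow> 'a set set set" where
  "extension_opens B =
     {U. \<exists>C \<in> extension_closeds B. is_complement (regular_open_algebra (proper_filters B)) C U}"

definition stone_cech_open_frame ::
    "('a :: {boolean_algebra, complete_lattice} \<Rightarrow> 'a) \<Rightarrow> 'a set set gorder" where
  "stone_cech_open_frame box =
     (regular_open_algebra (proper_filters (zero_elements box)))
       \<lparr>carrier := extension_opens (zero_elements box)\<rparr>"

section \<open>Frames and completely regular ideals\<close>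

locale frame = complete_lattice L for L (structure) +
  assumes meet_Sup_distrib:
    "\<lbrakk>a \<in> carrier L; S \<subseteq> carrier L\<rbrakk> \<Longrightarrow> a \<sqinter> \<Squnion>S = \<Squnion>((\<lambda>s. a \<sqinter> s) ` S)"

definition frame_hom ::
    "('a, 'c) gorder_scheme \<Rightarrow> ('b, 'd) gorder_scheme \<Rightarrow> ('a \<Rightarrow> 'b) \<Rightarrow> bool" where
  "frame_hom L K h \<longleftrightarrow>
     frame L \<and> frame K \<and> h \<in> carrier L \<rightarrow> carrier K \<and>
     sup_pres L K h \<and> meet_pres L K h \<and> h \<top>\<^bsub>L\<^esub> = \<top>\<^bsub>K\<^esub>"

definition frame_isomorphic ::
    "('a, 'c) gorder_scheme \<Rightarrow> ('b, 'd) gorder_scheme \<Rightarrow> bool" where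
  "frame_isomorphic L K \<longleftrightarrow> (\<exists>h. frame_hom L K h \<and> bij_betw h (carrier L) (carrier K))"

context
  fixes L :: "('a, 'c) gorder_scheme" (structure)
begin

definition pseudocomplement :: "'a \<Rightarrow> 'a" where
  "pseudocomplement a = \<Squnion>{x \<in> carrier L. a \<sqinter> x = \<bottom>}"

definition frame_well_below :: "'a \<Rightarrow> 'a \<Rightarrow> bool" where
  "frame_well_below a b \<longleftrightarrow> pseudocomplement a \<squnion> b = \<top>"

definition frame_completely_below :: "'a \<Rightarrow> 'a \<Rightarrow> bool" where
  "frame_completely_below a b \<longleftrightarrow>
     (\<exists>c :: rat \<Rightarrow> 'a. c ` {0..1} \<subseteq> carrier L \<and> a \<sqsubseteq> c 0 \<and> c 1 \<sqsubseteq> b \<and>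
        (\<forall>p\<in>{0..1}. \<forall>q\<in>{0..1}. p < q \<longrightarrow> frame_well_below (c p) (c q)))"

definition is_ideal :: "'a set \<Rightarrow> bool" where
  "is_ideal I \<longleftrightarrow>
     I \<subseteq> carrier L \<and> I \<noteq> {} \<and> (\<forall>a\<in>I. \<forall>b\<in>I. a \<squnion> b \<in> I) \<and>
     (\<forall>a\<in>I. \<forall>b\<in>carrier L. b \<sqsubseteq> a \<longrightarrow> b \<in> I)"

definition is_completely_regular_ideal :: "'a set \<Rightarrow> bool" where
  "is_completely_regular_ideal I \<longleftrightarrow>
     is_ideal I \<and> (\<forall>a\<in>I. \<exists>b\<in>I. frame_completely_below a b)"

definition beta_frame :: "'a set gorder" where
  "beta_frame = \<lparr>carrier = {I. is_completely_regular_ideal I}, eq = (=), le = (\<subseteq>)\<rparr>"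

end

end

theory Submission
  imports Defs
begin

text \<open>
  Closed elements of \<open>\<beta>M\<close> are the sets of filters \<open>C = \<Inter>{\<sigma>(z) | z \<in> T}\<close> with \<open>T\<close> a set of
  zero-elements. Such a \<open>C\<close> is sent to the ideal of those open \<open>u\<close> with \<open>u \<prec>\<prec> -z\<close> for some zero-element
  \<open>z\<close> with \<open>C \<subseteq> \<sigma>(z)\<close>, and a completely regular ideal \<open>I\<close> is sent to
  \<open>\<Inter>{\<sigma>(z) | -z \<in> I}\<close>. That these maps are mutually inverse rests on the pointfree form of the
  classical fact that disjoint zero-sets are completely separated: if \<open>a \<and> b = 0\<close> for zero-elements
  \<open>a, b\<close>, then \<open>a \<prec>\<prec> -b\<close>. As in the classical case, the lattice of zero-elements is normal, so the
  relation ``separated by disjoint zero-elements'' interpolates and Urysohn's dyadic subdivision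
  applies. The frame structure is then transported along the resulting order isomorphism.
\<close>

section \<open>Lattices presented as orders\<close>

text \<open>A complete Boolean algebra need not be completely distributive, so zero-elements cannot
  be computed with like sets of points. Joins are moved past infinite meets by residuation alone
  (\<open>x \<le> sup a b\<close> iff \<open>inf x (- a) \<le> b\<close>), and decreasing sequences
  make diagonal meets suffice. The points of \<beta>M are all proper filters, not only prime ones.
  The set of filters containing \<open>b\<close> need not be regular open; \<sigma>(b) asks instead
  that every extension of the filter be compatible with \<open>b\<close>. Arguments about \<sigma>
  thus work by enlarging a filter by one element. Asking for u \<prec>\<prec> -z rather than u \<le>
  -z makes the ideal completely regular. No information is lost, since \<sigma>(z) is the
  intersection of the \<sigma>(w) with w a zero-element and z \<prec>\<prec> w; this is the one
  point where separation of disjoint zero-elements enters. The frame laws are checked on the ideals,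
  where joins are finitary, and pulled back to the opens of \<beta>M, whose joins are never
  computed.\<close>

lemma (in partial_order) sup_eqI: "least L s (Upper L A) \<Longrightarrow> \<Squnion>A = s"
  unfolding sup_def by (rule some_equality) (auto intro: least_unique)

lemma (in partial_order) inf_eqI: "greatest L s (Lower L A) \<Longrightarrow> \<Sqinter>A = s"
  unfolding inf_def by (rule some_equality) (auto intro: greatest_unique)

lemma (in partial_order) bottom_eqI: "least L s (carrier L) \<Longrightarrow> \<bottom> = s"
  unfolding bottom_def by (rule some_equality) (auto intro: least_unique)

lemma (in partial_order) top_eqI: "greatest L s (carrier L) \<Longrightarrow> \<top> = s"
  unfolding top_def by (rule some_equality) (auto intro: greatest_unique)

lemma (in partial_order) complete_lattice_if_sup_exists:
  assumes sup_exists: "\<And>A. A \<subseteq> carrier L \<Longrightarrow> \<exists>s. least L s (Upper L A)"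
  shows "complete_lattice L"
proof (rule complete_latticeI)
  fix A
  assume A: "A \<subseteq> carrier L"
  obtain i where i: "least L i (Upper L (Lower L A))"
    using sup_exists[OF Lower_closed] by blast
  have "i \<sqsubseteq> x" if "x \<in> A" for x
    by (rule least_le[OF i]) (use that A in \<open>auto simp: Upper_def Lower_def\<close>)
  moreover have "x \<sqsubseteq> i" if "x \<in> Lower L A" for x
    using i that unfolding least_def Upper_def Lower_def by blast
  ultimately have "greatest L i (Lower L A)"
    by (intro greatest_LowerI A least_closed[OF i])
  then show "\<exists>i. greatest L i (Lower L A)" ..
qed (rule sup_exists)

text \<open>An order isomorphism reflects least upper and greatest lower bounds, so completeness and
  the distributive law of \<open>L\<close> are consequences of those of \<open>K\<close>. For the
  opens of \<beta>M only the order has to be understood.\<close>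

lemma frame_isomorphicI:
  assumes "frame K" "partial_order L"
    and bij: "bij_betw h (carrier L) (carrier K)"
    and le_iff: "\<And>x y. x \<in> carrier L \<Longrightarrow> y \<in> carrier L \<Longrightarrow> x \<sqsubseteq>\<^bsub>L\<^esub> y \<longleftrightarrow> h x \<sqsubseteq>\<^bsub>K\<^esub> h y"
  shows "frame_isomorphic L K"
proof -
  interpret K: frame K by fact
  interpret L: partial_order L by fact
  have h_closed: "h x \<in> carrier K" if "x \<in> carrier L" for x
    using bij that by (rule bij_betwE[rule_format])
  have h_image: "h ` S \<subseteq> carrier K" if "S \<subseteq> carrier L" for S
    using that h_closed by blast
  have surj: "\<exists>x \<in> carrier L. y = h x" if "y \<in> carrier K" for y
    using bij that unfolding bij_betw_def by blast
  have inj: "x = y" if "h x = h y" "x \<in> carrier L" "y \<in> carrier L" for x y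
    using bij that unfolding bij_betw_def inj_on_def by blast
  have lub: "least L s (Upper L S)"
    if "least K (h s) (Upper K (h ` S))" "s \<in> carrier L" "S \<subseteq> carrier L" for s S
  proof (rule least_UpperI)
    show "x \<sqsubseteq>\<^bsub>L\<^esub> s" if "x \<in> S" for x
      using least_Upper_above[OF \<open>least K (h s) (Upper K (h ` S))\<close> imageI[OF that] h_image]
        le_iff \<open>s \<in> carrier L\<close> \<open>S \<subseteq> carrier L\<close> that by blast
    show "s \<sqsubseteq>\<^bsub>L\<^esub> y" if y: "y \<in> Upper L S" for y
    proof -
      have "y \<in> carrier L"
        using y by (simp add: Upper_def)
      have "h y \<in> Upper K (h ` S)"
      proof (rule Upper_memI)
        fix t
        assume "t \<in> h ` S"
        then obtain x where "x \<in> S" "t = h x"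
          by blast
        then show "t \<sqsubseteq>\<^bsub>K\<^esub> h y"
          using Upper_memD[OF y _ \<open>S \<subseteq> carrier L\<close>] le_iff \<open>S \<subseteq> carrier L\<close> by blast
      qed (use h_closed \<open>y \<in> carrier L\<close> in blast)
      then show ?thesis
        using least_le[OF \<open>least K (h s) (Upper K (h ` S))\<close>] le_iff \<open>s \<in> carrier L\<close> \<open>y \<in> carrier L\<close>
        by blast
    qed
  qed (use that in auto)
  have glb: "greatest L s (Lower L S)"
    if "greatest K (h s) (Lower K (h ` S))" "s \<in> carrier L" "S \<subseteq> carrier L" for s S
  proof (rule greatest_LowerI)
    show "s \<sqsubseteq>\<^bsub>L\<^esub> x" if "x \<in> S" for x
      using greatest_Lower_below[OF \<open>greatest K (h s) (Lower K (h ` S))\<close> imageI[OF that] h_image]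
        le_iff \<open>s \<in> carrier L\<close> \<open>S \<subseteq> carrier L\<close> that by blast
    show "y \<sqsubseteq>\<^bsub>L\<^esub> s" if y: "y \<in> Lower L S" for y
    proof -
      have "y \<in> carrier L"
        using y by (simp add: Lower_def)
      have "h y \<in> Lower K (h ` S)"
      proof (rule Lower_memI)
        fix t
        assume "t \<in> h ` S"
        then obtain x where "x \<in> S" "t = h x"
          by blast
        then show "h y \<sqsubseteq>\<^bsub>K\<^esub> t"
          using Lower_memD[OF y _ \<open>S \<subseteq> carrier L\<close>] le_iff \<open>S \<subseteq> carrier L\<close> by blast
      qed (use h_closed \<open>y \<in> carrier L\<close> in blast)
      then show ?thesis
        using greatest_le[OF \<open>greatest K (h s) (Lower K (h ` S))\<close>] le_iff \<open>s \<in> carrier L\<close> \<open>y \<in> carrier L\<close>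
        by blast
    qed
  qed (use that in auto)
  have ex_lub: "\<exists>s \<in> carrier L. least L s (Upper L S) \<and> h s = \<Squnion>\<^bsub>K\<^esub>(h ` S)" if S: "S \<subseteq> carrier L" for S
  proof -
    obtain t where t: "least K t (Upper K (h ` S))"
      using K.sup_exists[OF h_image[OF S]] by blast
    then obtain s where "s \<in> carrier L" "t = h s"
      using surj[OF least_closed[OF t]] by blast
    with lub[of s S] S t K.sup_eqI[OF t] show ?thesis
      by auto
  qed
  have ex_glb: "\<exists>s \<in> carrier L. greatest L s (Lower L S) \<and> h s = \<Sqinter>\<^bsub>K\<^esub>(h ` S)" if S: "S \<subseteq> carrier L" for S
  proof -
    obtain t where t: "greatest K t (Lower K (h ` S))"
      using K.inf_exists[OF h_image[OF S]] by blast
    then obtain s where "s \<in> carrier L" "t = h s"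
      using surj[OF greatest_closed[OF t]] by blast
    with glb[of s S] S t K.inf_eqI[OF t] show ?thesis
      by auto
  qed
  interpret L: complete_lattice L
  proof (rule L.complete_latticeI)
    fix S
    assume "S \<subseteq> carrier L"
    from ex_lub[OF this] ex_glb[OF this]
    show "\<exists>s. least L s (Upper L S)" "\<exists>s. greatest L s (Lower L S)"
      by blast+
  qed
  have h_Sup: "h (\<Squnion>\<^bsub>L\<^esub>S) = \<Squnion>\<^bsub>K\<^esub>(h ` S)" if "S \<subseteq> carrier L" for S
    using ex_lub[OF that] by (auto simp: L.sup_eqI)
  have h_meet: "h (x \<sqinter>\<^bsub>L\<^esub> y) = h x \<sqinter>\<^bsub>K\<^esub> h y" if "x \<in> carrier L" "y \<in> carrier L" for x y
    using ex_glb[of "{x, y}"] that unfolding meet_def by (auto simp: L.inf_eqI)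
  have "h \<top>\<^bsub>L\<^esub> = \<top>\<^bsub>K\<^esub>"
  proof (rule K.le_antisym)
    obtain x where x: "x \<in> carrier L" "\<top>\<^bsub>K\<^esub> = h x"
      using surj[OF K.top_closed] by blast
    then show "\<top>\<^bsub>K\<^esub> \<sqsubseteq>\<^bsub>K\<^esub> h \<top>\<^bsub>L\<^esub>"
      using le_iff[OF x(1) L.top_closed] L.top_higher[OF x(1)] by simp
  qed (use h_closed in simp_all)
  moreover have "frame L"
  proof
    fix a S
    assume aS: "a \<in> carrier L" "S \<subseteq> carrier L"
    have meets: "(\<lambda>s. a \<sqinter>\<^bsub>L\<^esub> s) ` S \<subseteq> carrier L"
      using aS by auto
    have "h (a \<sqinter>\<^bsub>L\<^esub> \<Squnion>\<^bsub>L\<^esub>S) = h a \<sqinter>\<^bsub>K\<^esub> \<Squnion>\<^bsub>K\<^esub>(h ` S)"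
      using aS by (simp add: h_meet h_Sup)
    also have "\<dots> = \<Squnion>\<^bsub>K\<^esub>((\<lambda>s. h a \<sqinter>\<^bsub>K\<^esub> s) ` h ` S)"
      by (intro K.meet_Sup_distrib h_closed h_image aS)
    also have "(\<lambda>s. h a \<sqinter>\<^bsub>K\<^esub> s) ` h ` S = h ` (\<lambda>s. a \<sqinter>\<^bsub>L\<^esub> s) ` S"
      using aS h_meet by (auto simp: image_image subset_eq intro!: image_cong)
    also have "\<Squnion>\<^bsub>K\<^esub>\<dots> = h (\<Squnion>\<^bsub>L\<^esub>((\<lambda>s. a \<sqinter>\<^bsub>L\<^esub> s) ` S))"
      by (rule h_Sup[OF meets, symmetric])
    finally show "a \<sqinter>\<^bsub>L\<^esub> \<Squnion>\<^bsub>L\<^esub>S = \<Squnion>\<^bsub>L\<^esub>((\<lambda>s. a \<sqinter>\<^bsub>L\<^esub> s) ` S)"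
      by (rule inj) (use aS meets in simp_all)
  qed
  ultimately have "frame_hom L K h"
    unfolding frame_hom_def sup_pres_def meet_pres_def
    using \<open>frame K\<close> h_closed h_Sup h_meet L.complete_lattice_axioms K.complete_lattice_axioms
    by simp
  with bij show ?thesis
    unfolding frame_isomorphic_def by blast
qed

section \<open>Orders carried by a subset of an ordered type\<close>

lemma partial_order_class: "partial_order \<lparr>carrier = A, eq = (=), le = (\<le>)\<rparr>"
  for A :: "'a :: order set"
  by unfold_locales auto

lemma least_Upper_classI:
  fixes A :: "'a :: order set"
  assumes "s \<in> A" "\<And>x. x \<in> S \<Longrightarrow> x \<le> s" "\<And>u. u \<in> A \<Longrightarrow> (\<And>x. x \<in> S \<Longrightarrow> x \<le> u) \<Longrightarrow> s \<le> u" "S \<subseteq> A"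
  shows "least \<lparr>carrier = A, eq = (=), le = (\<le>)\<rparr> s (Upper \<lparr>carrier = A, eq = (=), le = (\<le>)\<rparr> S)"
  using assms unfolding least_def Upper_def by auto

lemma greatest_Lower_classI:
  fixes A :: "'a :: order set"
  assumes "s \<in> A" "\<And>x. x \<in> S \<Longrightarrow> s \<le> x" "\<And>u. u \<in> A \<Longrightarrow> (\<And>x. x \<in> S \<Longrightarrow> u \<le> x) \<Longrightarrow> u \<le> s" "S \<subseteq> A"
  shows "greatest \<lparr>carrier = A, eq = (=), le = (\<le>)\<rparr> s (Lower \<lparr>carrier = A, eq = (=), le = (\<le>)\<rparr> S)"
  using assms unfolding greatest_def Lower_def by auto

lemmas sup_class_eqI = partial_order.sup_eqI[OF partial_order_class least_Upper_classI]
lemmas inf_class_eqI = partial_order.inf_eqI[OF partial_order_class greatest_Lower_classI]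

lemma le_sup_compl: "x \<le> sup a b \<longleftrightarrow> inf x (- a) \<le> b" for x a b :: "'a :: boolean_algebra"
  by (metis inf.commute shunt1 double_compl sup.commute)

text \<open>Residuation turns each \<open>sup\<close> into a lower bound for a single meet, one
  argument at a time; this replaces distributivity over meets. The premise ranges over all pairs of
  indices, not just the diagonal.\<close>

lemma sup_INF_greatest:
  fixes f g :: "nat \<Rightarrow> 'a :: {boolean_algebra, complete_lattice}"
  assumes "\<And>m n. x \<le> sup (f m) (g n)"
  shows "x \<le> sup (INF n. f n) (INF n. g n)"
proof -
  have "inf x (- f m) \<le> (INF n. g n)" for m
    by (rule INF_greatest) (rule le_sup_compl[THEN iffD1, OF assms])
  then have "inf x (- (INF n. g n)) \<le> f m" for m
    by (metis le_sup_compl sup.commute)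
  then have "inf x (- (INF n. g n)) \<le> (INF m. f m)"
    by (rule INF_greatest)
  then show ?thesis
    by (metis le_sup_compl sup.commute)
qed

lemma inf_Sup_finite:
  fixes u :: "'a :: {boolean_algebra, complete_lattice}"
  assumes "finite A"
  shows "inf u (Sup A) = Sup (inf u ` A)"
  using assms by (induction rule: finite_induct) (simp_all add: inf_sup_distrib1)

section \<open>Regular open upsets\<close>

text \<open>Brings the algebra into the record shape of \<open>sup_class_eqI\<close> and
  \<open>inf_class_eqI\<close>, with the carrier left folded.\<close>

lemma regular_open_algebra_eq:
  "regular_open_algebra X = \<lparr>carrier = carrier (regular_open_algebra X), eq = (=), le = (\<subseteq>)\<rparr>"
  by (simp add: regular_open_algebra_def)

lemma regular_open_iff:
  "U \<in> carrier (regular_open_algebra X) \<longleftrightarrow>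
    upset X U \<and> U = {x \<in> X. \<forall>y\<in>X. x \<le> y \<longrightarrow> (\<exists>z\<in>U. y \<le> z)}"
  unfolding regular_open_algebra_def partial_object.simps mem_Collect_eq by (rule refl)

text \<open>The other half of regularity comes from the second premise: for \<open>x\<close> in
  \<open>U\<close>, each \<open>y\<close> above \<open>x\<close> is its own witness.\<close>

lemma regular_openI:
  assumes "U \<subseteq> X" "\<And>x y. x \<in> U \<Longrightarrow> y \<in> X \<Longrightarrow> x \<le> y \<Longrightarrow> y \<in> U"
    and "\<And>x. x \<in> X \<Longrightarrow> (\<And>y. y \<in> X \<Longrightarrow> x \<le> y \<Longrightarrow> \<exists>z\<in>U. y \<le> z) \<Longrightarrow> x \<in> U"
  shows "U \<in> carrier (regular_open_algebra X)"
  unfolding regular_open_iff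
proof
  show "upset X U"
    using assms(1,2) unfolding upset_def by blast
  show "U = {x \<in> X. \<forall>y\<in>X. x \<le> y \<longrightarrow> (\<exists>z\<in>U. y \<le> z)}"
    using assms by blast
qed

lemma regular_openD:
  assumes U: "U \<in> carrier (regular_open_algebra X)"
  shows "U \<subseteq> X" "\<And>x y. x \<in> U \<Longrightarrow> y \<in> X \<Longrightarrow> x \<le> y \<Longrightarrow> y \<in> U"
    and "\<And>x. x \<in> X \<Longrightarrow> (\<And>y. y \<in> X \<Longrightarrow> x \<le> y \<Longrightarrow> \<exists>z\<in>U. y \<le> z) \<Longrightarrow> x \<in> U"
proof -
  have "upset X U"
    using U unfolding regular_open_iff ..
  then show "U \<subseteq> X" "\<And>x y. x \<in> U \<Longrightarrow> y \<in> X \<Longrightarrow> x \<le> y \<Longrightarrow> y \<in> U"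
    unfolding upset_def by blast+
  have eq: "U = {x \<in> X. \<forall>y\<in>X. x \<le> y \<longrightarrow> (\<exists>z\<in>U. y \<le> z)}"
    using U unfolding regular_open_iff ..
  show "x \<in> U" if "x \<in> X" "\<And>y. y \<in> X \<Longrightarrow> x \<le> y \<Longrightarrow> \<exists>z\<in>U. y \<le> z" for x
    by (subst eq) (use that in blast)
qed

text \<open>The intersection with \<open>X\<close> gives the empty family its correct meet, the top
  element.\<close>

lemma regular_open_Inter:
  assumes "S \<subseteq> carrier (regular_open_algebra X)"
  shows "X \<inter> \<Inter>S \<in> carrier (regular_open_algebra X)"
proof (rule regular_openI)
  fix x y
  assume xy: "x \<in> X \<inter> \<Inter>S" "y \<in> X" "x \<le> y"
  have "y \<in> U" if "U \<in> S" for U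
    by (rule regular_openD(2)[of U X x]) (use that assms xy in auto)
  with xy show "y \<in> X \<inter> \<Inter>S"
    by blast
next
  fix x
  assume x: "x \<in> X" "\<And>y. y \<in> X \<Longrightarrow> x \<le> y \<Longrightarrow> \<exists>z\<in>X \<inter> \<Inter>S. y \<le> z"
  have "x \<in> U" if "U \<in> S" for U
    by (rule regular_openD(3)[of U X]) (use that assms x in blast)+
  with x show "x \<in> X \<inter> \<Inter>S"
    by blast
qed blast

lemma regular_open_inf:
  assumes "S \<subseteq> carrier (regular_open_algebra X)"
  shows "\<Sqinter>\<^bsub>regular_open_algebra X\<^esub>S = X \<inter> \<Inter>S"
proof (subst regular_open_algebra_eq, rule inf_class_eqI)
  show "U \<subseteq> X \<inter> \<Inter>S" if "U \<in> carrier (regular_open_algebra X)" "\<And>V. V \<in> S \<Longrightarrow> U \<subseteq> V" for U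
    using that(2) regular_openD(1)[OF that(1)] by blast
qed (use assms regular_open_Inter in blast)+

text \<open>The interior of a closure is regular open for any set \<open>U\<close>; with
  \<open>U\<close> a union this yields the joins of the algebra.\<close>

lemma regular_open_interior_closure:
  shows "{x \<in> X. \<forall>y\<in>X. x \<le> y \<longrightarrow> (\<exists>z\<in>U. y \<le> z)} \<in> carrier (regular_open_algebra X)"
proof (rule regular_openI)
  fix x
  assume x: "x \<in> X" "\<And>y. y \<in> X \<Longrightarrow> x \<le> y \<Longrightarrow>
    \<exists>z\<in>{x \<in> X. \<forall>y\<in>X. x \<le> y \<longrightarrow> (\<exists>z\<in>U. y \<le> z)}. y \<le> z"
  have "\<exists>w\<in>U. y \<le> w" if "y \<in> X" "x \<le> y" for y
    using x(2)[OF that] by (auto intro: order_trans)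
  with x(1) show "x \<in> {x \<in> X. \<forall>y\<in>X. x \<le> y \<longrightarrow> (\<exists>z\<in>U. y \<le> z)}"
    by blast
qed (auto intro: order_trans)

lemma regular_open_sup:
  assumes "S \<subseteq> carrier (regular_open_algebra X)"
  shows "\<Squnion>\<^bsub>regular_open_algebra X\<^esub>S = {x \<in> X. \<forall>y\<in>X. x \<le> y \<longrightarrow> (\<exists>z\<in>\<Union>S. y \<le> z)}" (is "_ = ?R")
proof (subst regular_open_algebra_eq, rule sup_class_eqI)
  show "?R \<in> carrier (regular_open_algebra X)"
    by (rule regular_open_interior_closure)
  show "U \<subseteq> ?R" if "U \<in> S" for U
  proof -
    have "U \<in> carrier (regular_open_algebra X)"
      using that assms by blast
    from regular_openD(1,2)[OF this] that show ?thesis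
      by blast
  qed
  show "?R \<subseteq> V" if V: "V \<in> carrier (regular_open_algebra X)" "\<And>U. U \<in> S \<Longrightarrow> U \<subseteq> V" for V
  proof
    fix x
    assume "x \<in> ?R"
    then show "x \<in> V"
      using V(2) by (intro regular_openD(3)[OF V(1)]) blast+
  qed
qed (rule assms)

text \<open>The interior of the set-theoretic complement, which is the Boolean complement in the
  algebra of regular opens.\<close>

definition upset_complement :: "'p :: order set \<Rightarrow> 'p set \<Rightarrow> 'p set" where
  "upset_complement X U = {x \<in> X. \<forall>y\<in>X. x \<le> y \<longrightarrow> y \<notin> U}"

lemma upset_complement_closed:
  assumes "U \<in> carrier (regular_open_algebra X)"
  shows "upset_complement X U \<in> carrier (regular_open_algebra X)"
  unfolding upset_complement_def
proof (rule regular_openI)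
  fix x
  assume x: "x \<in> X" "\<And>y. y \<in> X \<Longrightarrow> x \<le> y \<Longrightarrow> \<exists>z\<in>{x \<in> X. \<forall>y\<in>X. x \<le> y \<longrightarrow> y \<notin> U}. y \<le> z"
  have "y \<notin> U" if "y \<in> X" "x \<le> y" for y
    using x(2)[OF that] regular_openD(2)[OF assms, of y] by blast
  with x(1) show "x \<in> {x \<in> X. \<forall>y\<in>X. x \<le> y \<longrightarrow> y \<notin> U}"
    by blast
qed (auto intro: order_trans)

lemma upset_complement_antimono: "U \<subseteq> V \<Longrightarrow> upset_complement X V \<subseteq> upset_complement X U"
  unfolding upset_complement_def by blast

text \<open>Lying in the double complement means that every point above has a point of
  \<open>U\<close> above it, so the nontrivial inclusion is regularity itself.\<close>

lemma upset_complement_involutive: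
  assumes "U \<in> carrier (regular_open_algebra X)"
  shows "upset_complement X (upset_complement X U) = U"
proof (intro equalityI subsetI)
  fix x
  assume "x \<in> upset_complement X (upset_complement X U)"
  then show "x \<in> U"
    by (intro regular_openD(3)[OF assms]) (auto simp: upset_complement_def)
next
  fix x
  assume "x \<in> U"
  then show "x \<in> upset_complement X (upset_complement X U)"
    using regular_openD(1,2)[OF assms] by (auto simp: upset_complement_def)
qed

text \<open>Disjointness places \<open>U\<close> inside the complement because \<open>U\<close> is
  an upset. Conversely, above any \<open>y\<close> in reach of a point of the complement, the
  covering condition provides a point of \<open>C\<close> or \<open>U\<close>; the former is
  excluded, and regularity of \<open>U\<close> concludes.\<close>

lemma is_complement_regular_open_iff:
  assumes C: "C \<in> carrier (regular_open_algebra X)"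
  shows "is_complement (regular_open_algebra X) C U \<longleftrightarrow> U = upset_complement X C"
proof -
  let ?L = "regular_open_algebra X"
  interpret partial_order ?L
    by (subst regular_open_algebra_eq) (rule partial_order_class)
  have top: "\<top>\<^bsub>?L\<^esub> = X"
    by (rule top_eqI) (auto simp: greatest_def regular_open_algebra_def upset_def)
  have bot: "\<bottom>\<^bsub>?L\<^esub> = {}"
    by (rule bottom_eqI) (auto simp: least_def regular_open_algebra_def upset_def)
  have meet: "C \<sqinter>\<^bsub>?L\<^esub> V = X \<inter> (C \<inter> V)" if "V \<in> carrier ?L" for V
    unfolding meet_def using regular_open_inf[of "{C, V}" X] C that by simp
  have join: "C \<squnion>\<^bsub>?L\<^esub> V = {x \<in> X. \<forall>y\<in>X. x \<le> y \<longrightarrow> (\<exists>z\<in>C \<union> V. y \<le> z)}"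
    if "V \<in> carrier ?L" for V
    unfolding join_def using regular_open_sup[of "{C, V}" X] C that by simp
  show ?thesis
  proof
    assume "is_complement ?L C U"
    then have U: "U \<in> carrier ?L" and "C \<sqinter>\<^bsub>?L\<^esub> U = {}" "C \<squnion>\<^bsub>?L\<^esub> U = X"
      unfolding is_complement_def top bot by blast+
    then have disjoint: "X \<inter> (C \<inter> U) = {}"
      and cover: "{x \<in> X. \<forall>y\<in>X. x \<le> y \<longrightarrow> (\<exists>z\<in>C \<union> U. y \<le> z)} = X"
      using meet[OF U] join[OF U] by simp_all
    show "U = upset_complement X C"
    proof (intro equalityI subsetI)
      fix x
      assume "x \<in> U"
      then show "x \<in> upset_complement X C"
        using regular_openD(1,2)[OF U] disjoint by (auto simp: upset_complement_def)
    next
      fix x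
      assume x: "x \<in> upset_complement X C"
      show "x \<in> U"
      proof (rule regular_openD(3)[OF U])
        show "x \<in> X"
          using x by (simp add: upset_complement_def)
      next
        fix y
        assume y: "y \<in> X" "x \<le> y"
        then obtain z where "z \<in> C \<union> U" "y \<le> z"
          using cover by blast
        moreover have "z \<notin> C"
          using x y \<open>y \<le> z\<close> regular_openD(1)[OF C] by (auto simp: upset_complement_def)
        ultimately show "\<exists>z\<in>U. y \<le> z"
          by blast
      qed
    qed
  next
    assume "U = upset_complement X C"
    moreover have "X \<inter> (C \<inter> upset_complement X C) = {}"
      by (auto simp: upset_complement_def)
    moreover have "{x \<in> X. \<forall>y\<in>X. x \<le> y \<longrightarrow> (\<exists>z\<in>C \<union> upset_complement X C. y \<le> z)} = X"
      by (auto simp: upset_complement_def)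
    ultimately show "is_complement ?L C U"
      unfolding is_complement_def top bot
      using C upset_complement_closed[OF C] meet join by simp
  qed
qed

section \<open>Filters\<close>

lemma proper_filters_iff:
  fixes B :: "'b :: bounded_lattice set"
  assumes "bot \<in> B"
  shows "F \<in> proper_filters B \<longleftrightarrow> is_filter B F \<and> bot \<notin> F"
  using assms unfolding proper_filters_def is_filter_def by (auto intro: bot_least)

text \<open>The filter generated by \<open>F\<close> and \<open>b\<close> is proper because
  \<open>b\<close> is compatible with every member of \<open>F\<close>. This is the principle that
  produces larger points; no prime filters are involved.\<close>

lemma proper_filters_extend:
  fixes B :: "'b :: bounded_lattice set"
  assumes "bot \<in> B" and inf_closed: "\<And>a b. a \<in> B \<Longrightarrow> b \<in> B \<Longrightarrow> inf a b \<in> B"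
    and F: "F \<in> proper_filters B" and b: "b \<in> B" "\<And>a. a \<in> F \<Longrightarrow> inf b a \<noteq> bot"
  obtains G where "G \<in> proper_filters B" "F \<subseteq> G" "b \<in> G"
proof -
  have filter: "is_filter B F"
    using F by (simp add: proper_filters_def)
  then have "F \<noteq> {}" "F \<subseteq> B"
    by (simp_all add: is_filter_def)
  then obtain t where t: "t \<in> F"
    by blast
  have inf_F: "inf c d \<in> F" if "c \<in> F" "d \<in> F" for c d
    using filter that by (simp add: is_filter_def)
  define G where "G = {c \<in> B. \<exists>a\<in>F. inf b a \<le> c}"
  have "is_filter B G"
    unfolding is_filter_def
  proof (intro conjI ballI impI)
    show "G \<noteq> {}"
      using t \<open>b \<in> B\<close> inf_le1[of b t] unfolding G_def by blast
  next
    fix c d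
    assume "c \<in> G" "d \<in> G"
    then obtain a a' where a: "a \<in> F" "inf b a \<le> c" "a' \<in> F" "inf b a' \<le> d" and "c \<in> B" "d \<in> B"
      unfolding G_def by blast
    have "inf b (inf a a') \<le> inf b a" "inf b (inf a a') \<le> inf b a'"
      by (simp_all add: inf.coboundedI2)
    with a have "inf b (inf a a') \<le> inf c d"
      by (meson inf_greatest order_trans)
    then show "inf c d \<in> G"
      unfolding G_def using inf_closed[OF \<open>c \<in> B\<close> \<open>d \<in> B\<close>] inf_F[OF a(1,3)] by blast
  qed (auto simp: G_def intro: order_trans)
  moreover have "bot \<notin> G"
    using b(2) by (auto simp: G_def bot_unique)
  ultimately have "G \<in> proper_filters B"
    using proper_filters_iff[OF \<open>bot \<in> B\<close>] by blast
  moreover have "F \<subseteq> G"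
    using \<open>F \<subseteq> B\<close> inf_le2[of b] unfolding G_def by blast
  moreover have "b \<in> G"
    using t \<open>b \<in> B\<close> inf_le1[of b t] unfolding G_def by blast
  ultimately show thesis
    by (rule that)
qed

text \<open>Quantifying over all extensions builds regularity in: an element of \<open>y\<close>
  also belongs to the filter \<open>z\<close> above \<open>y\<close>, and \<open>z\<close> is tested
  as an extension of itself.\<close>

lemma sigma_regular_open: "sigma B a \<in> carrier (regular_open_algebra (proper_filters B))"
proof (rule regular_openI)
  fix x
  assume x: "x \<in> proper_filters B" "\<And>y. y \<in> proper_filters B \<Longrightarrow> x \<subseteq> y \<Longrightarrow> \<exists>z\<in>sigma B a. y \<subseteq> z"
  have "inf a b \<noteq> bot" if "y \<in> proper_filters B" "x \<subseteq> y" "b \<in> y" for y b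
    using x(2)[OF that(1,2)] that(3) unfolding sigma_def by blast
  with x(1) show "x \<in> sigma B a"
    unfolding sigma_def by blast
next
  fix x y
  assume "x \<in> sigma B a" "y \<in> proper_filters B" "x \<subseteq> y"
  then have "inf a b \<noteq> bot" if "z \<in> proper_filters B" "y \<subseteq> z" "b \<in> z" for z b
    using that subset_trans[of x y z] unfolding sigma_def by blast
  with \<open>y \<in> proper_filters B\<close> show "y \<in> sigma B a"
    unfolding sigma_def by blast
qed (simp add: sigma_def)

lemma sigma_mono:
  assumes "a \<le> b"
  shows "sigma B a \<subseteq> sigma B b"
proof -
  have "inf a c \<noteq> bot \<Longrightarrow> inf b c \<noteq> bot" for c
    using assms by (metis bot_unique inf_mono order_refl)
  then show ?thesis
    unfolding sigma_def by blast
qed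

text \<open>Being compatible with \<open>a\<close> and with \<open>b\<close> does not by itself give
  compatibility with the meet; stability under extension does. Membership in
  \<open>sigma B b\<close> allows \<open>y\<close> to be enlarged by \<open>b\<close>, and testing
  \<open>a\<close> against \<open>inf b c\<close> in the larger filter gives the claim.\<close>

lemma sigma_inf:
  assumes "bot \<in> B" "\<And>a b. a \<in> B \<Longrightarrow> b \<in> B \<Longrightarrow> inf a b \<in> B" "b \<in> B"
  shows "sigma B a \<inter> sigma B b \<subseteq> sigma B (inf a b)"
proof
  fix x
  assume x: "x \<in> sigma B a \<inter> sigma B b"
  have "inf (inf a b) c \<noteq> bot" if y: "y \<in> proper_filters B" "x \<subseteq> y" "c \<in> y" for y c
  proof -
    have "\<And>a. a \<in> y \<Longrightarrow> inf b a \<noteq> bot"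
      using x y unfolding sigma_def by blast
    then obtain z where z: "z \<in> proper_filters B" "y \<subseteq> z" "b \<in> z"
      using proper_filters_extend[OF assms(1,2) y(1) assms(3)] by metis
    then have "inf b c \<in> z"
      using y(3) unfolding proper_filters_def is_filter_def by blast
    then have "inf a (inf b c) \<noteq> bot"
      using x y z unfolding sigma_def by blast
    then show ?thesis
      by (simp add: inf.assoc)
  qed
  moreover have "x \<in> proper_filters B"
    using x by (simp add: sigma_def)
  ultimately show "x \<in> sigma B (inf a b)"
    by (simp add: sigma_def)
qed

lemma sigma_top:
  assumes "bot \<in> B"
  shows "sigma B top_class.top = proper_filters B"
  using proper_filters_iff[OF assms] by (auto simp: sigma_def)

lemma mem_sigma:
  assumes "bot \<in> B" "x \<in> proper_filters B" "b \<in> x"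
  shows "x \<in> sigma B b"
proof -
  have "inf b c \<noteq> bot" if y: "y \<in> proper_filters B" "x \<subseteq> y" "c \<in> y" for y c
  proof -
    have "is_filter B y" "bot \<notin> y"
      using y(1) proper_filters_iff[OF assms(1)] by auto
    then have "inf b c \<in> y"
      using y assms(3) by (auto simp: is_filter_def)
    with \<open>bot \<notin> y\<close> show ?thesis
      by auto
  qed
  with assms(2) show ?thesis
    by (simp add: sigma_def)
qed

text \<open>Meets of the algebra written as intersections; the restriction to proper filters makes
  the empty meet the whole space.\<close>

definition sigma_Inter :: "'b :: bounded_lattice set \<Rightarrow> 'b set \<Rightarrow> 'b set set" where
  "sigma_Inter B T = {x \<in> proper_filters B. \<forall>b\<in>T. x \<in> sigma B b}"

lemma sigma_Inter_regular_open:
  "sigma_Inter B T \<in> carrier (regular_open_algebra (proper_filters B))"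
proof -
  have "sigma_Inter B T = proper_filters B \<inter> \<Inter>(sigma B ` T)"
    by (auto simp: sigma_Inter_def)
  moreover have "sigma B ` T \<subseteq> carrier (regular_open_algebra (proper_filters B))"
    using sigma_regular_open by blast
  ultimately show ?thesis
    by (simp only: regular_open_Inter)
qed

lemma extension_closeds_eq: "extension_closeds B = sigma_Inter B ` Pow B"
proof -
  have "\<Sqinter>\<^bsub>regular_open_algebra (proper_filters B)\<^esub>(sigma B ` T) = sigma_Inter B T" for T
    by (subst regular_open_inf) (use sigma_regular_open in \<open>auto simp: sigma_Inter_def\<close>)
  then show ?thesis
    unfolding extension_closeds_def by (auto simp: subset_image_iff)
qed

lemma extension_opens_eq:
  "extension_opens B = (\<lambda>T. upset_complement (proper_filters B) (sigma_Inter B T)) ` Pow B"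
  unfolding extension_opens_def extension_closeds_eq
  using is_complement_regular_open_iff[OF sigma_Inter_regular_open] by blast

section \<open>MT-algebras\<close>

context mt_algebra
begin

abbreviation wb (infix "\<prec>" 50) where "a \<prec> b \<equiv> well_below box a b"
abbreviation cb (infix "\<prec>\<prec>" 50) where "a \<prec>\<prec> b \<equiv> completely_below box a b"

lemma box_mono: "a \<le> b \<Longrightarrow> box a \<le> box b"
  by (metis box_meet inf.absorb_iff1 inf.cobounded2)

lemma le_dia: "a \<le> dia box a"
  unfolding dia_def using box_le[of "- a"] compl_le_swap1 by blast

lemma dia_mono: "a \<le> b \<Longrightarrow> dia box a \<le> dia box b"
  unfolding dia_def using box_mono[of "- b" "- a"] by simp

lemma box_idem: "box (box a) = box a"
  by (simp add: antisym box_le box_le_box_box)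

lemma dia_idem: "dia box (dia box a) = dia box a"
  unfolding dia_def by (simp add: box_idem)

lemma dia_compl: "dia box (- a) = - box a"
  unfolding dia_def by simp

lemma box_compl: "box (- a) = - dia box a"
  unfolding dia_def by simp

lemma opens_box: "box a \<in> opens box"
  unfolding opens_def by (simp add: box_idem)

lemma closeds_dia: "dia box a \<in> closeds box"
  unfolding closeds_def by (simp add: dia_idem)

lemma compl_opens_iff: "- a \<in> opens box \<longleftrightarrow> a \<in> closeds box"
  unfolding opens_def closeds_def by (auto simp: box_compl)

lemma opens_Sup:
  assumes "A \<subseteq> opens box"
  shows "Sup A \<in> opens box"
proof -
  have "a \<le> box (Sup A)" if "a \<in> A" for a
    using that assms box_mono[OF Sup_upper[OF that]] unfolding opens_def by auto
  then show ?thesis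
    unfolding opens_def by (auto intro!: antisym Sup_least box_le)
qed

lemma opens_sup: "a \<in> opens box \<Longrightarrow> b \<in> opens box \<Longrightarrow> sup a b \<in> opens box"
  using opens_Sup[of "{a, b}"] by simp

lemma opens_inf: "a \<in> opens box \<Longrightarrow> b \<in> opens box \<Longrightarrow> inf a b \<in> opens box"
  unfolding opens_def using box_meet by auto

lemma opens_bot: "bot \<in> opens box"
  using opens_Sup[of "{}"] by simp

lemma opens_top: "top_class.top \<in> opens box"
  unfolding opens_def using box_one by simp

lemma closeds_INF:
  assumes "\<And>i. i \<in> A \<Longrightarrow> f i \<in> closeds box"
  shows "(INF i\<in>A. f i) \<in> closeds box"
proof -
  have "dia box (INF i\<in>A. f i) \<le> f i" if "i \<in> A" for i
    using that assms[OF that] dia_mono[OF INF_lower[OF that, of f]] unfolding closeds_def by auto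
  then show ?thesis
    unfolding closeds_def by (auto intro!: antisym INF_greatest le_dia)
qed

section \<open>The relations \<open>\<prec>\<close> and \<open>\<prec>\<prec>\<close>\<close>

lemma well_below_mono: "a' \<le> a \<Longrightarrow> a \<prec> b \<Longrightarrow> b \<le> b' \<Longrightarrow> a' \<prec> b'"
  unfolding well_below_def by (meson box_mono dia_mono order_trans)

lemma well_below_le: "a \<prec> b \<Longrightarrow> a \<le> b"
  unfolding well_below_def by (meson box_le le_dia order_trans)

lemma well_below_compl: "a \<prec> b \<Longrightarrow> - b \<prec> - a"
  unfolding well_below_def by (simp add: box_compl dia_compl)

lemma well_below_inf:
  assumes "a \<prec> b" "a' \<prec> b'"
  shows "inf a a' \<prec> inf b b'"
proof -
  have "dia box (inf a a') \<le> inf (dia box a) (dia box a')"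
    by (simp add: dia_mono)
  also have "\<dots> \<le> inf (box b) (box b')"
    using assms unfolding well_below_def by (meson inf_mono)
  finally show ?thesis
    by (simp add: well_below_def box_meet)
qed

lemma completely_below_mono: "a' \<le> a \<Longrightarrow> a \<prec>\<prec> b \<Longrightarrow> b \<le> b' \<Longrightarrow> a' \<prec>\<prec> b'"
  unfolding completely_below_def by (meson order_trans)

lemma completely_below_compl:
  assumes "a \<prec>\<prec> b"
  shows "- b \<prec>\<prec> - a"
proof -
  obtain c where c: "a \<le> c 0" "c 1 \<le> b"
    "\<And>p q :: rat. 0 \<le> p \<Longrightarrow> p < q \<Longrightarrow> q \<le> 1 \<Longrightarrow> c p \<prec> c q"
    using assms unfolding completely_below_def by fastforce
  show ?thesis
    unfolding completely_below_def
    by (rule exI[of _ "\<lambda>p. - c (1 - p)"]) (use c in \<open>auto intro!: well_below_compl\<close>)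
qed

lemma completely_below_inf:
  assumes "a \<prec>\<prec> b" "a' \<prec>\<prec> b'"
  shows "inf a a' \<prec>\<prec> inf b b'"
proof -
  obtain c where c: "a \<le> c 0" "c 1 \<le> b"
    "\<And>p q :: rat. 0 \<le> p \<Longrightarrow> p < q \<Longrightarrow> q \<le> 1 \<Longrightarrow> c p \<prec> c q"
    using assms(1) unfolding completely_below_def by fastforce
  obtain c' where c': "a' \<le> c' 0" "c' 1 \<le> b'"
    "\<And>p q :: rat. 0 \<le> p \<Longrightarrow> p < q \<Longrightarrow> q \<le> 1 \<Longrightarrow> c' p \<prec> c' q"
    using assms(2) unfolding completely_below_def by fastforce
  show ?thesis
    unfolding completely_below_def
    by (rule exI[of _ "\<lambda>p. inf (c p) (c' p)"])
      (use c c' in \<open>auto intro!: well_below_inf intro: le_infI1 le_infI2\<close>)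
qed

lemma completely_below_sup:
  assumes "a \<prec>\<prec> b" "a' \<prec>\<prec> b'"
  shows "sup a a' \<prec>\<prec> sup b b'"
  using completely_below_compl[OF completely_below_inf[OF assms[THEN completely_below_compl]]]
  by simp

lemma completely_below_bot: "bot \<prec>\<prec> a"
  unfolding completely_below_def well_below_def dia_def
  by (rule exI[of _ "\<lambda>_. bot"]) (simp add: box_one)

lemma completely_below_top: "a \<prec>\<prec> top_class.top"
  unfolding completely_below_def well_below_def
  by (rule exI[of _ "\<lambda>_. top_class.top"]) (simp add: box_one)

text \<open>The affine map from [0, 1] onto [p, q] turns the segment of a scale into a scale, so all
  interpolants can be read off one scale.\<close>

lemma completely_below_segment:
  fixes c :: "rat \<Rightarrow> 'a"
  assumes c: "\<And>p q. 0 \<le> p \<Longrightarrow> p < q \<Longrightarrow> q \<le> 1 \<Longrightarrow> c p \<prec> c q"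
    and "0 \<le> p" "p < q" "q \<le> 1"
  shows "c p \<prec>\<prec> c q"
proof -
  define d where "d r = c (p + (q - p) * r)" for r
  have "d r \<prec> d s" if rs: "0 \<le> r" "r < s" "s \<le> 1" for r s
    unfolding d_def
  proof (rule c)
    show "0 \<le> p + (q - p) * r"
      using \<open>0 \<le> p\<close> \<open>p < q\<close> rs by simp
    show "p + (q - p) * r < p + (q - p) * s"
      using \<open>p < q\<close> rs by simp
    have "(q - p) * s \<le> (q - p) * 1"
      using \<open>p < q\<close> rs by (intro mult_left_mono) simp_all
    then have "p + (q - p) * s \<le> q"
      by simp
    then show "p + (q - p) * s \<le> 1"
      using \<open>q \<le> 1\<close> by (rule order_trans)
  qed
  moreover have "d 0 = c p" "d 1 = c q"
    by (simp_all add: d_def)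
  ultimately have "c p \<le> d 0" "d 1 \<le> c q" "\<forall>p\<in>{0..1}. \<forall>q\<in>{0..1}. p < q \<longrightarrow> d p \<prec> d q"
    by auto
  then show ?thesis
    unfolding completely_below_def by blast
qed

lemma completely_below_scale:
  assumes "a \<prec>\<prec> b"
  obtains c :: "rat \<Rightarrow> 'a" where "a \<le> c 0" "c 1 \<le> b"
    "\<And>p q. 0 \<le> p \<Longrightarrow> p < q \<Longrightarrow> q \<le> 1 \<Longrightarrow> c p \<prec> c q"
    "\<And>p q. 0 \<le> p \<Longrightarrow> p < q \<Longrightarrow> q \<le> 1 \<Longrightarrow> c p \<prec>\<prec> c q"
proof -
  obtain c where c: "a \<le> c 0" "c 1 \<le> b"
    "\<And>p q :: rat. 0 \<le> p \<Longrightarrow> p < q \<Longrightarrow> q \<le> 1 \<Longrightarrow> c p \<prec> c q"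
    using assms unfolding completely_below_def by fastforce
  show thesis
    by (rule that[OF c completely_below_segment[OF c(3)]])
qed

lemma completely_below_le:
  assumes "a \<prec>\<prec> b"
  shows "a \<le> b"
proof -
  obtain c :: "rat \<Rightarrow> 'a" where c: "a \<le> c 0" "c 1 \<le> b"
    "\<And>p q. 0 \<le> p \<Longrightarrow> p < q \<Longrightarrow> q \<le> 1 \<Longrightarrow> c p \<prec> c q"
    using assms unfolding completely_below_def by fastforce
  have "c 0 \<le> c 1"
    by (intro well_below_le c(3)) simp_all
  with c(1,2) show ?thesis
    by (meson order_trans)
qed

lemma completely_below_interpolate:
  assumes "a \<prec>\<prec> b"
  obtains w where "w \<in> opens box" "a \<prec>\<prec> w" "w \<prec>\<prec> b"
proof -
  obtain c :: "rat \<Rightarrow> 'a" where c: "a \<le> c 0" "c 1 \<le> b"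
    "\<And>p q. 0 \<le> p \<Longrightarrow> p < q \<Longrightarrow> q \<le> 1 \<Longrightarrow> c p \<prec> c q"
    "\<And>p q. 0 \<le> p \<Longrightarrow> p < q \<Longrightarrow> q \<le> 1 \<Longrightarrow> c p \<prec>\<prec> c q"
    using completely_below_scale[OF assms] by blast
  \<comment> \<open>The middle value of the scale need not be open. Its interior still dominates the
    slightly earlier value at 1/3, which leaves the segment from 0 to 1/3 to witness
    \<open>\<prec>\<prec>\<close> on the left.\<close>
  have "c (1/3) \<le> box (c (1/2))"
    using c(3)[of "1/3" "1/2"] order_trans[OF le_dia] unfolding well_below_def by auto
  then have "a \<prec>\<prec> box (c (1/2))"
    using completely_below_mono[OF c(1) c(4)[of 0 "1/3"]] by simp
  moreover have "box (c (1/2)) \<prec>\<prec> b"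
    using completely_below_mono[OF box_le c(4)[of "1/2" 1] c(2)] by simp
  ultimately show thesis
    using that opens_box by blast
qed

text \<open>Dyadic subdivision, as in Urysohn's lemma.\<close>
lemma completely_belowI_interpolative:
  assumes "R x y"
    and wb: "\<And>a b. R a b \<Longrightarrow> a \<prec> b"
    and interpolate: "\<And>a b. R a b \<Longrightarrow> \<exists>c. R a c \<and> R c b"
  shows "x \<prec>\<prec> y"
proof -
  obtain g where g: "\<And>a b. R a b \<Longrightarrow> R a (g a b)" "\<And>a b. R a b \<Longrightarrow> R (g a b) b"
    using interpolate by metis
  \<comment> \<open>\<open>d n k\<close> is the value at the dyadic number \<open>k / 2 ^ n\<close>.
    A refinement keeps the old values at even indices and places an interpolant at each odd index;
    on level 0 only the indices 0 and 1 matter.\<close>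
  define d :: "nat \<Rightarrow> nat \<Rightarrow> 'a" where
    "d = rec_nat (\<lambda>k. if k = 0 then x else y)
      (\<lambda>n e k. if even k then e (k div 2) else g (e (k div 2)) (e (Suc (k div 2))))"
  have d0: "d 0 k = (if k = 0 then x else y)" for k
    by (simp add: d_def)
  have dSuc: "d (Suc n) k =
      (if even k then d n (k div 2) else g (d n (k div 2)) (d n (Suc (k div 2))))" for n k
    by (simp add: d_def)
  have step: "R (d n k) (d n (Suc k))" if "k < 2 ^ n" for n k
    using that
  proof (induction n arbitrary: k)
    case 0
    then show ?case
      using \<open>R x y\<close> by (simp add: d0)
  next
    case (Suc n)
    then have "R (d n (k div 2)) (d n (Suc (k div 2)))"
      by simp
    then show ?case
      by (auto simp: dSuc g)
  qed
  \<comment> \<open>Values do not depend on how a dyadic number is written, so points of levels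
    \<open>n\<close> and \<open>m\<close> can be compared on the common level
    \<open>n + m\<close>.\<close>
  have d_refine: "d (n + m) (2 ^ m * k) = d n k" for n m k
    by (induction m) (auto simp: dSuc mult.assoc)
  have d_mono: "d n i \<le> d n j" if "i \<le> j" "j \<le> 2 ^ n" for n i j
    using that
  proof (induction rule: dec_induct)
    case (step m)
    then show ?case
      using well_below_le[OF wb[OF \<open>\<And>k n. k < 2 ^ n \<Longrightarrow> R (d n k) (d n (Suc k))\<close>, of m n]] by auto
  qed simp
  have d_le: "d n k \<le> d m j"
    if "of_nat k \<le> p * 2 ^ n" "p * 2 ^ m \<le> of_nat j" "j \<le> 2 ^ m" for n k m j and p :: rat
  proof -
    have "of_nat (2 ^ m * k) \<le> (of_nat (2 ^ n * j) :: rat)"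
    proof -
      have "of_nat (2 ^ m * k) \<le> 2 ^ m * (p * 2 ^ n)"
        using that(1) by simp
      also have "\<dots> = 2 ^ n * (p * 2 ^ m)"
        by simp
      also have "\<dots> \<le> of_nat (2 ^ n * j)"
        using that(2) by simp
      finally show ?thesis .
    qed
    then have "2 ^ m * k \<le> 2 ^ n * j"
      by (simp only: of_nat_le_iff)
    then have "d (n + m) (2 ^ m * k) \<le> d (n + m) (2 ^ n * j)"
      using that(3) by (intro d_mono) (auto simp: power_add)
    then show ?thesis
      using d_refine[of n m k] d_refine[of m n j] by (simp add: add.commute)
  qed
  \<comment> \<open>A scale must be indexed by all rationals, so the dyadic values are extended by
    suprema from below.\<close>
  define c :: "rat \<Rightarrow> 'a" where
    "c p = Sup {d n k | n k. k \<le> 2 ^ n \<and> of_nat k \<le> p * 2 ^ n}" for p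
  have le_c: "d n k \<le> c p" if "k \<le> 2 ^ n" "of_nat k \<le> p * 2 ^ n" for n k p
    unfolding c_def by (rule Sup_upper) (use that in blast)
  have c_le: "c p \<le> d m j" if "p * 2 ^ m \<le> of_nat j" "j \<le> 2 ^ m" for m j p
    unfolding c_def by (rule Sup_least) (use d_le that in blast)
  have "c p \<prec> c q" if "0 \<le> p" "p < q" "q \<le> 1" for p q
  proof -
    \<comment> \<open>The grid must be fine enough for a whole step from \<open>k\<close> to
      \<open>Suc k\<close> to fit between \<open>p\<close> and \<open>q\<close>: rounding
      \<open>p\<close> up costs less than one unit and the step costs one more, hence the 2. That
      single step supplies \<open>\<prec>\<close>.\<close>
    obtain n where n: "2 / (q - p) < 2 ^ n"
      using real_arch_pow[of 2 "of_rat (2 / (q - p))"]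
      by (metis (no_types, opaque_lifting) of_rat_less of_rat_numeral_eq of_rat_power one_less_numeral_iff semiring_norm(76))
    then have n: "2 < q * 2 ^ n - p * 2 ^ n"
      using that by (simp add: field_simps)
    define k where "k = nat \<lceil>p * 2 ^ n\<rceil>"
    have k: "p * 2 ^ n \<le> of_nat k" "of_nat k < p * 2 ^ n + 1"
      unfolding k_def using that by (auto simp: of_nat_nat) linarith
    have "q * 2 ^ n \<le> 2 ^ n"
      using that by simp
    moreover have "of_nat (Suc k) = of_nat k + (1 :: rat)"
      by simp
    ultimately have "of_nat (Suc k) \<le> (2 ^ n :: rat)"
      using k n by linarith
    then have "Suc k \<le> 2 ^ n"
      by (metis of_nat_le_iff of_nat_numeral of_nat_power)
    show ?thesis
    proof (rule well_below_mono)
      show "c p \<le> d n k"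
        using k \<open>Suc k \<le> 2 ^ n\<close> by (intro c_le) auto
      show "d n k \<prec> d n (Suc k)"
        using step wb \<open>Suc k \<le> 2 ^ n\<close> by simp
      show "d n (Suc k) \<le> c q"
        using k n \<open>Suc k \<le> 2 ^ n\<close> by (intro le_c) auto
    qed
  qed
  moreover have "x \<le> c 0"
    using le_c[of 0 0 0] by (simp add: d0)
  moreover have "c 1 \<le> y"
    using c_le[of 1 0 1] by (simp add: d0)
  ultimately show ?thesis
    unfolding completely_below_def by auto
qed

subsection \<open>Zero-elements\<close>

lemma zero_elementsE:
  assumes "z \<in> zero_elements box"
  obtains c where "\<And>n. c n \<in> closeds box" "z = (INF n. c n)" "\<And>n. c (Suc n) \<prec>\<prec> c n" "decseq c"
proof -
  obtain c where c: "\<And>n. c n \<in> closeds box" "z = (INF n. c n)" "\<And>n. c (Suc n) \<prec>\<prec> c n"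
    using assms unfolding zero_elements_def by blast
  moreover have "decseq c"
    using c(3) by (intro decseq_SucI completely_below_le)
  ultimately show thesis
    by (rule that)
qed

lemma zero_elements_closeds: "z \<in> zero_elements box \<Longrightarrow> z \<in> closeds box"
  by (metis zero_elementsE closeds_INF)

lemma compl_zero_elements_opens: "z \<in> zero_elements box \<Longrightarrow> - z \<in> opens box"
  by (simp add: compl_opens_iff zero_elements_closeds)

lemma zero_elements_bot: "bot \<in> zero_elements box"
proof -
  have "bot \<in> closeds box"
    using compl_opens_iff[of bot] opens_top by simp
  then show ?thesis
    unfolding zero_elements_def by (auto intro!: exI[of _ "\<lambda>_. bot"] completely_below_bot)
qed

lemma zero_elements_top: "top_class.top \<in> zero_elements box"
proof -
  have "top_class.top \<in> closeds box"
    using compl_opens_iff[of top_class.top] opens_bot by simp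
  then show ?thesis
    unfolding zero_elements_def
    by (auto intro!: exI[of _ "\<lambda>_. top_class.top"] completely_below_top)
qed

lemma zero_element_between:
  assumes "a \<prec>\<prec> b"
  obtains z where "z \<in> zero_elements box" "a \<le> z" "z \<le> b"
proof -
  obtain c :: "rat \<Rightarrow> 'a" where c: "a \<le> c 0" "c 1 \<le> b"
    "\<And>p q. 0 \<le> p \<Longrightarrow> p < q \<Longrightarrow> q \<le> 1 \<Longrightarrow> c p \<prec> c q"
    "\<And>p q. 0 \<le> p \<Longrightarrow> p < q \<Longrightarrow> q \<le> 1 \<Longrightarrow> c p \<prec>\<prec> c q"
    using completely_below_scale[OF assms] by blast
  have dia_le: "dia box (c p) \<le> c q" if "0 \<le> p" "p < q" "q \<le> 1" for p q
    using c(3)[OF that] order_trans[OF _ box_le] unfolding well_below_def by blast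
  \<comment> \<open>The indices decrease but stay positive, which keeps all terms above
    \<open>c 0\<close>; starting at 1/2 leaves room for the closure of the first term below
    \<open>c 1\<close>. Closures make the terms closed.\<close>
  define e where "e n = dia box (c (1 / (of_nat n + 2)))" for n
  have "e (Suc n) \<prec>\<prec> e n" for n
  proof -
    \<comment> \<open>Taking closures moves \<open>e (Suc n)\<close> above the value at 1/(n+3), so
      the strict gap to 1/(n+2) is split: up to \<open>s\<close> it absorbs the closure, beyond
      \<open>s\<close> it provides \<open>\<prec>\<prec>\<close>.\<close>
    obtain s :: rat where s: "1 / (of_nat n + 3) < s" "s < 1 / (of_nat n + 2)"
      using dense[of "1 / (of_nat n + 3) :: rat" "1 / (of_nat n + 2)"]
      by (auto simp: frac_less2)
    have "0 \<le> 1 / (of_nat n + 3 :: rat)" "1 / (of_nat n + 2 :: rat) \<le> 1"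
      by auto
    then have *: "0 \<le> s" "s \<le> 1" "1 / (of_nat n + 2 :: rat) \<le> 1"
      using s by linarith+
    show ?thesis
    proof (rule completely_below_mono)
      show "e (Suc n) \<le> c s"
        unfolding e_def using dia_le[of "1 / (of_nat n + 3)" s] s * by (simp add: add.commute add.left_commute)
      show "c s \<prec>\<prec> c (1 / (of_nat n + 2))"
        using s * by (intro c(4))
      show "c (1 / (of_nat n + 2)) \<le> e n"
        unfolding e_def by (rule le_dia)
    qed
  qed
  moreover have "e n \<in> closeds box" for n
    unfolding e_def by (rule closeds_dia)
  ultimately have "(INF n. e n) \<in> zero_elements box"
    unfolding zero_elements_def by blast
  moreover have "a \<le> (INF n. e n)"
  proof (rule INF_greatest)
    fix n
    have "c 0 \<le> c (1 / (of_nat n + 2))"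
      by (intro well_below_le c(3)) auto
    then show "a \<le> e n"
      unfolding e_def by (meson c(1) le_dia order_trans)
  qed
  moreover have "(INF n. e n) \<le> b"
  proof -
    have "(INF n. e n) \<le> e 0"
      by (rule INF_lower) simp
    also have "\<dots> \<le> c 1"
      unfolding e_def by (intro dia_le) simp_all
    also have "\<dots> \<le> b"
      by (rule c(2))
    finally show ?thesis .
  qed
  ultimately show thesis
    by (rule that)
qed

lemma zero_element_interpolate:
  assumes "a \<prec>\<prec> b"
  obtains z where "z \<in> zero_elements box" "a \<prec>\<prec> z" "z \<prec>\<prec> b"
proof -
  obtain v where v: "a \<prec>\<prec> v" "v \<prec>\<prec> b"
    using completely_below_interpolate[OF assms] by blast
  obtain w where w: "v \<prec>\<prec> w" "w \<prec>\<prec> b"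
    using completely_below_interpolate[OF v(2)] by blast
  obtain z where "z \<in> zero_elements box" "v \<le> z" "z \<le> w"
    using zero_element_between[OF w(1)] by blast
  then show thesis
    using that completely_below_mono[OF order_refl v(1)] completely_below_mono[OF _ w(2) order_refl]
    by blast
qed

lemma zero_elements_INF:
  assumes "\<And>k :: nat. f k \<in> zero_elements box"
  shows "(INF k. f k) \<in> zero_elements box"
proof -
  have "\<forall>k. \<exists>c. (\<forall>n. c n \<in> closeds box) \<and> f k = (INF n. c n) \<and>
      (\<forall>n. c (Suc n) \<prec>\<prec> c n) \<and> decseq c"
    using assms by (metis zero_elementsE)
  then obtain c where c: "\<And>k n. c k n \<in> closeds box" "\<And>k. f k = (INF n. c k n)"
    "\<And>k n. c k (Suc n) \<prec>\<prec> c k n" "\<And>k. decseq (c k)"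
    by metis
  \<comment> \<open>A triangular truncation: each \<open>d n\<close> is a finite meet, and only
    finite meets are known to respect \<open>\<prec>\<prec>\<close>. Passing from
    \<open>Suc n\<close> to \<open>n\<close> discards one index and lowers the level of the
    others.\<close>
  define d where "d n = (INF k\<in>{..n}. c k n)" for n
  \<comment> \<open>The number of indices and the level are decoupled so that the induction runs
    over the former only.\<close>
  have below_INF: "(INF k\<in>{..n}. c k (Suc m)) \<prec>\<prec> (INF k\<in>{..n}. c k m)" for n m
  proof (induction n)
    case (Suc n)
    then show ?case
      using c(3) by (simp add: atMost_Suc completely_below_inf)
  qed (simp add: c(3))
  have "d (Suc n) \<prec>\<prec> d n" for n
    unfolding d_def
    by (rule completely_below_mono[OF _ below_INF order_refl]) (rule INF_superset_mono; simp)
  moreover have "d n \<in> closeds box" for n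
    unfolding d_def by (intro closeds_INF c)
  moreover have "(INF k. f k) = (INF n. d n)"
  proof (rule antisym)
    show "(INF k. f k) \<le> (INF n. d n)"
      unfolding c(2) d_def by (auto intro!: INF_greatest intro: INF_lower2)
    show "(INF n. d n) \<le> (INF k. f k)"
      unfolding c(2)
    proof (intro INF_greatest)
      fix k n
      have "d (max k n) \<le> c k (max k n)"
        unfolding d_def by (rule INF_lower) simp
      also have "\<dots> \<le> c k n"
        using c(4) by (simp add: decseqD)
      finally show "(INF n. d n) \<le> c k n"
        by (meson INF_lower2 UNIV_I)
    qed
  qed
  ultimately show ?thesis
    unfolding zero_elements_def by blast
qed

lemma zero_elements_inf:
  assumes "a \<in> zero_elements box" "b \<in> zero_elements box"
  shows "inf a b \<in> zero_elements box"
proof -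
  obtain c where c: "\<And>n. c n \<in> closeds box" "a = (INF n. c n)" "\<And>n. c (Suc n) \<prec>\<prec> c n"
    using zero_elementsE[OF assms(1)] by metis
  obtain d where d: "\<And>n. d n \<in> closeds box" "b = (INF n. d n)" "\<And>n. d (Suc n) \<prec>\<prec> d n"
    using zero_elementsE[OF assms(2)] by metis
  have "inf (c n) (d n) \<in> closeds box" for n
    using c(1)[of n] d(1)[of n] opens_sup[of "- c n" "- d n"]
    by (simp flip: compl_opens_iff)
  moreover have "inf a b = (INF n. inf (c n) (d n))"
    unfolding c(2) d(2) by (simp add: INF_inf_distrib)
  moreover have "inf (c (Suc n)) (d (Suc n)) \<prec>\<prec> inf (c n) (d n)" for n
    using c(3) d(3) by (rule completely_below_inf)
  ultimately show ?thesis
    unfolding zero_elements_def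
    by (intro CollectI exI[of _ "\<lambda>n. inf (c n) (d n)"] conjI allI)
qed

text \<open>Since both sequences decrease, the diagonal term at \<open>max m n\<close> lies below
  \<open>sup (c m) (d n)\<close>. Hence the diagonal meet is already the join of the two
  meets.\<close>

lemma zero_elements_sup:
  assumes "a \<in> zero_elements box" "b \<in> zero_elements box"
  shows "sup a b \<in> zero_elements box"
proof -
  obtain c where c: "\<And>n. c n \<in> closeds box" "a = (INF n. c n)" "\<And>n. c (Suc n) \<prec>\<prec> c n" "decseq c"
    using zero_elementsE[OF assms(1)] by metis
  obtain d where d: "\<And>n. d n \<in> closeds box" "b = (INF n. d n)" "\<And>n. d (Suc n) \<prec>\<prec> d n" "decseq d"
    using zero_elementsE[OF assms(2)] by metis
  have "(INF n. sup (c n) (d n)) \<le> sup a b"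
    unfolding c(2) d(2)
  proof (rule sup_INF_greatest)
    fix m n
    have "(INF n. sup (c n) (d n)) \<le> sup (c (max m n)) (d (max m n))"
      by (rule INF_lower) simp
    also have "\<dots> \<le> sup (c m) (d n)"
      using c(4) d(4) by (intro sup_mono) (simp_all add: decseqD)
    finally show "(INF n. sup (c n) (d n)) \<le> sup (c m) (d n)" .
  qed
  moreover have "sup a b \<le> (INF n. sup (c n) (d n))"
    unfolding c(2) d(2) by (intro INF_greatest sup_mono INF_lower) auto
  moreover have "sup (c n) (d n) \<in> closeds box" for n
    using c(1)[of n] d(1)[of n] opens_inf[of "- c n" "- d n"]
    by (simp flip: compl_opens_iff)
  moreover have "sup (c (Suc n)) (d (Suc n)) \<prec>\<prec> sup (c n) (d n)" for n
    using c(3) d(3) by (rule completely_below_sup)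
  ultimately show ?thesis
    unfolding zero_elements_def
    by (intro CollectI exI[of _ "\<lambda>n. sup (c n) (d n)"] conjI allI antisym)
qed

text \<open>A zero-element is the meet of zero-elements \<open>f n\<close> that are neighbourhoods
  of it in the strong sense that the complement of a zero-element fits in between. This is the input
  to normality.\<close>

lemma zero_element_approx:
  assumes "z \<in> zero_elements box"
  obtains f g where "\<And>n. f n \<in> zero_elements box" "\<And>n. g n \<in> zero_elements box"
    "\<And>n. z \<le> - g n" "\<And>n. - g n \<le> f n" "z = (INF n. f n)" "decseq f"
proof -
  obtain c where c: "\<And>n. c n \<in> closeds box" "z = (INF n. c n)" "\<And>n. c (Suc n) \<prec>\<prec> c n" "decseq c"
    using zero_elementsE[OF assms] by metis
  \<comment> \<open>The indices are chosen so that \<open>z \<le> c (Suc (Suc n)) \<le> - g n \<le>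
    c (Suc n) \<le> f n \<le> c n\<close>.\<close>
  have "\<exists>x \<in> zero_elements box. c (Suc n) \<le> x \<and> x \<le> c n" for n
    using zero_element_between[OF c(3)[of n]] by metis
  then obtain f where f: "\<And>n. f n \<in> zero_elements box" "\<And>n. c (Suc n) \<le> f n" "\<And>n. f n \<le> c n"
    by metis
  have "\<exists>x \<in> zero_elements box. - c (Suc n) \<le> x \<and> x \<le> - c (Suc (Suc n))" for n
    using zero_element_between[OF completely_below_compl[OF c(3)[of "Suc n"]]] by metis
  then obtain g where g: "\<And>n. g n \<in> zero_elements box" "\<And>n. - c (Suc n) \<le> g n"
    "\<And>n. g n \<le> - c (Suc (Suc n))"
    by metis
  have z_le: "z \<le> c n" for n
    unfolding c(2) by (rule INF_lower) simp
  have "z \<le> - g n" for n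
    using z_le[of "Suc (Suc n)"] g(3)[of n] by (meson compl_le_swap1 order_trans)
  moreover have "- g n \<le> f n" for n
    using f(2)[of n] g(2)[of n] by (meson compl_le_swap2 order_trans)
  moreover have "z = (INF n. f n)"
  proof (rule antisym)
    show "z \<le> (INF n. f n)"
      using z_le f(2) by (meson INF_greatest order_trans)
    show "(INF n. f n) \<le> z"
      unfolding c(2) using f(3) by (intro INF_mono) auto
  qed
  moreover have "f (Suc n) \<le> f n" for n
    using f(3)[of "Suc n"] f(2)[of n] by (rule order_trans)
  then have "decseq f"
    by (rule decseq_SucI)
  ultimately show thesis
    using that f g by blast
qed

text \<open>The interleaving argument by which countable covers yield normality, phrased through
  complements: \<open>- u\<close> and \<open>- v\<close> are disjoint open neighbourhoods of
  \<open>b\<close> and \<open>a\<close>.\<close>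

lemma zero_elements_normal:
  assumes "a \<in> zero_elements box" "b \<in> zero_elements box" "inf a b = bot"
  obtains u v where "u \<in> zero_elements box" "v \<in> zero_elements box"
    "sup u v = top_class.top" "inf u b = bot" "inf v a = bot"
proof -
  obtain f g where f: "\<And>n. f n \<in> zero_elements box" "\<And>n. g n \<in> zero_elements box"
    "\<And>n. a \<le> - g n" "\<And>n. - g n \<le> f n" "a = (INF n. f n)" "decseq f"
    using zero_element_approx[OF assms(1)] by metis
  obtain f' g' where f': "\<And>n. f' n \<in> zero_elements box" "\<And>n. g' n \<in> zero_elements box"
    "\<And>n. b \<le> - g' n" "\<And>n. - g' n \<le> f' n" "b = (INF n. f' n)" "decseq f'"
    using zero_element_approx[OF assms(2)] by metis
  \<comment> \<open>Dually, \<open>- u\<close> is the join of the parts of \<open>- g' n\<close>, a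
    neighbourhood of \<open>b\<close>, that avoid \<open>f n\<close>. Since the \<open>f n\<close>
    shrink to \<open>a\<close>, these parts exhaust \<open>b\<close>.\<close>
  define u v where "u = (INF n. sup (f n) (g' n))" and "v = (INF n. sup (f' n) (g n))"
  \<comment> \<open>Below \<open>y\<close> the summand \<open>k n\<close> vanishes, so each term of
    the meet is bounded by \<open>h n\<close> and the whole meet by \<open>x\<close>.\<close>
  have disjoint: "inf (INF n. sup (h n) (k n)) y = bot"
    if "x = (INF n. h n)" "\<And>n. y \<le> - k n" "inf x y = bot" for h k :: "nat \<Rightarrow> 'a" and x y
  proof -
    have "inf (INF n. sup (h n) (k n)) y \<le> h n" for n
    proof -
      have "inf (INF n. sup (h n) (k n)) y \<le> inf (sup (k n) (h n)) (- k n)"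
        using that(2) by (intro inf_mono) (auto intro: INF_lower2 simp: sup.commute)
      also have "\<dots> \<le> h n"
        by (simp flip: le_sup_compl)
      finally show ?thesis .
    qed
    then have "inf (INF n. sup (h n) (k n)) y \<le> inf x y"
      unfolding that(1) by (auto intro: INF_greatest)
    then show ?thesis
      using that(3) by (simp add: bot_unique)
  qed
  have "top_class.top \<le> sup u v"
    unfolding u_def v_def
  proof (rule sup_INF_greatest)
    fix m n
    \<comment> \<open>\<open>- k j \<le> h j \<le> h i\<close>. Comparing \<open>m\<close> with
      \<open>n\<close> decides which of the two sequences plays the role of
      \<open>h\<close>.\<close>
    have cover: "top_class.top \<le> sup (h i) (k j)"
      if "- k j \<le> h j" "decseq h" "i \<le> j" for h k :: "nat \<Rightarrow> 'a" and i j
      using that by (metis decseqD order_trans le_sup_compl inf_top_left sup.commute)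
    show "top_class.top \<le> sup (sup (f m) (g' m)) (sup (f' n) (g n))"
    proof (cases "m \<le> n")
      case True
      show ?thesis
        by (rule order_trans[OF cover[of g n f m]]) (use f True in \<open>auto intro: le_supI1 le_supI2\<close>)
    next
      case False
      show ?thesis
        by (rule order_trans[OF cover[of g' m f' n]])
          (use f' False in \<open>auto intro: le_supI1 le_supI2\<close>)
    qed
  qed
  moreover have "u \<in> zero_elements box" "v \<in> zero_elements box"
    unfolding u_def v_def by (auto intro!: zero_elements_INF zero_elements_sup f f')
  moreover have "inf u b = bot" "inf v a = bot"
    unfolding u_def v_def using disjoint[OF f(5) f'(3)] disjoint[OF f'(5) f(3)] assms(3)
    by (simp_all add: inf.commute)
  ultimately show thesis
    using that by (simp add: top_unique)
qed

lemma completely_below_compl_disjoint: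
  assumes "a \<in> zero_elements box" "b \<in> zero_elements box" "inf a b = bot"
  shows "a \<prec>\<prec> - b"
proof -
  \<comment> \<open>The interpolants will be complements of zero-elements rather than zero-elements,
    so \<open>R\<close> accepts any element that lies below a zero-element on the left, and dually
    on the right.\<close>
  define R where "R x y \<longleftrightarrow>
    (\<exists>a \<in> zero_elements box. \<exists>b \<in> zero_elements box. x \<le> a \<and> inf a b = bot \<and> - b \<le> y)" for x y
  show ?thesis
  proof (rule completely_belowI_interpolative[of R])
    show "R a (- b)"
      using assms unfolding R_def by blast
  next
    fix x y
    assume "R x y"
    then obtain a b where ab: "a \<in> zero_elements box" "b \<in> zero_elements box" "x \<le> a"
      "inf a b = bot" "- b \<le> y"
      unfolding R_def by blast
    then have "dia box a = a" "box (- b) = - b" "a \<le> - b"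
      using zero_elements_closeds compl_zero_elements_opens
      by (auto simp: closeds_def opens_def inf_shunt)
    then show "x \<prec> y"
      using ab by (intro well_below_mono[of x a "- b" y]) (auto simp: well_below_def)
    obtain u v where uv: "u \<in> zero_elements box" "v \<in> zero_elements box"
      "sup u v = top_class.top" "inf u b = bot" "inf v a = bot"
      using zero_elements_normal[OF ab(1,2,4)] by blast
    \<comment> \<open>\<open>- v\<close> interpolates: on the left the pair \<open>a\<close>,
      \<open>v\<close> is disjoint, on the right the pair \<open>u\<close>, \<open>b\<close> is,
      with \<open>u\<close> as the zero-element above \<open>- v\<close>.\<close>
    have "- v \<le> u"
      using uv(3) by (metis compl_sup_top double_compl inf_shunt sup.commute sup_shunt)
    then have "R x (- v)" "R (- v) y"
      unfolding R_def using ab uv by (metis inf.commute order_refl)+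
    then show "\<exists>c. R x c \<and> R c y"
      by blast
  qed
qed

subsection \<open>The frame of open elements\<close>

lemma open_frame_join: "a \<in> opens box \<Longrightarrow> b \<in> opens box \<Longrightarrow> a \<squnion>\<^bsub>open_frame box\<^esub> b = sup a b"
  unfolding join_def open_frame_def by (rule sup_class_eqI) (auto simp: opens_sup)

lemma open_frame_meet: "a \<in> opens box \<Longrightarrow> b \<in> opens box \<Longrightarrow> a \<sqinter>\<^bsub>open_frame box\<^esub> b = inf a b"
  unfolding meet_def open_frame_def by (rule inf_class_eqI) (auto simp: opens_inf)

lemma open_frame_bottom: "\<bottom>\<^bsub>open_frame box\<^esub> = bot"
  unfolding open_frame_def
  by (rule partial_order.bottom_eqI[OF partial_order_class]) (simp add: least_def opens_bot)

lemma open_frame_top: "\<top>\<^bsub>open_frame box\<^esub> = top_class.top"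
  unfolding open_frame_def
  by (rule partial_order.top_eqI[OF partial_order_class]) (simp add: greatest_def opens_top)

lemma open_frame_simps: "carrier (open_frame box) = opens box" "x \<sqsubseteq>\<^bsub>open_frame box\<^esub> y \<longleftrightarrow> x \<le> y"
  by (simp_all add: open_frame_def)

lemma open_frame_pseudocomplement:
  assumes "a \<in> opens box"
  shows "pseudocomplement (open_frame box) a = box (- a)"
proof -
  have le: "x \<le> box (- a)" if "x \<in> opens box" "inf a x = bot" for x
  proof -
    have "x \<le> - a"
      using that(2) by (metis inf_shunt inf.commute)
    then show ?thesis
      using that(1) box_mono[of x "- a"] by (simp add: opens_def)
  qed
  have "inf a (box (- a)) \<le> inf a (- a)"
    using box_le by (rule inf_mono[OF order_refl])
  then have "inf a (box (- a)) = bot"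
    by (simp add: bot_unique)
  then have "least (open_frame box) (box (- a))
      (Upper (open_frame box) {x \<in> opens box. inf a x = bot})"
    unfolding open_frame_def using le by (intro least_Upper_classI) (auto simp: opens_box)
  moreover have "{x \<in> carrier (open_frame box). a \<sqinter>\<^bsub>open_frame box\<^esub> x = \<bottom>\<^bsub>open_frame box\<^esub>} =
      {x \<in> opens box. inf a x = bot}"
    using assms by (auto simp: open_frame_meet open_frame_bottom open_frame_simps)
  moreover have "partial_order (open_frame box)"
    unfolding open_frame_def by (rule partial_order_class)
  ultimately show ?thesis
    unfolding pseudocomplement_def by (simp add: partial_order.sup_eqI)
qed

lemma open_frame_well_below_iff:
  assumes "a \<in> opens box" "b \<in> opens box"
  shows "frame_well_below (open_frame box) a b \<longleftrightarrow> a \<prec> b"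
proof -
  have "frame_well_below (open_frame box) a b \<longleftrightarrow> sup (- dia box a) b = top_class.top"
    using assms opens_box[of "- a"]
    by (simp add: frame_well_below_def open_frame_pseudocomplement open_frame_join open_frame_top box_compl)
  also have "\<dots> \<longleftrightarrow> dia box a \<le> b"
    by (simp add: sup_shunt)
  also have "\<dots> \<longleftrightarrow> a \<prec> b"
    using assms by (simp add: well_below_def opens_def)
  finally show ?thesis .
qed

text \<open>A frame scale has open values and is a scale of the algebra as it stands. Conversely,
  taking interiors makes any scale open: it can only shrink \<open>dia box (c p)\<close>, while
  \<open>box (c q)\<close> is unchanged, and the lower end survives because \<open>a\<close> is
  open.\<close>

lemma open_frame_completely_below_iff:
  assumes "a \<in> opens box" "b \<in> opens box"
  shows "frame_completely_below (open_frame box) a b \<longleftrightarrow> a \<prec>\<prec> b"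
proof
  assume "frame_completely_below (open_frame box) a b"
  then obtain c :: "rat \<Rightarrow> 'a" where c: "c ` {0..1} \<subseteq> opens box" "a \<le> c 0" "c 1 \<le> b"
    "\<forall>p\<in>{0..1}. \<forall>q\<in>{0..1}. p < q \<longrightarrow> frame_well_below (open_frame box) (c p) (c q)"
    unfolding frame_completely_below_def open_frame_simps by blast
  have "c p \<prec> c q" if "p \<in> {0..1}" "q \<in> {0..1}" "p < q" for p q
    using c(1,4) that open_frame_well_below_iff[of "c p" "c q"] by blast
  with c(2,3) show "a \<prec>\<prec> b"
    unfolding completely_below_def by blast
next
  assume "a \<prec>\<prec> b"
  then obtain c :: "rat \<Rightarrow> 'a" where c: "a \<le> c 0" "c 1 \<le> b"
    "\<forall>p\<in>{0..1}. \<forall>q\<in>{0..1}. p < q \<longrightarrow> c p \<prec> c q"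
    unfolding completely_below_def by blast
  have "frame_well_below (open_frame box) (box (c p)) (box (c q))"
    if "p \<in> {0..1}" "q \<in> {0..1}" "p < q" for p q
  proof -
    have "dia box (box (c p)) \<le> dia box (c p)"
      by (intro dia_mono box_le)
    also have "\<dots> \<le> box (c q)"
      using c(3) that unfolding well_below_def by blast
    finally have "box (c p) \<prec> box (c q)"
      by (simp add: well_below_def box_idem)
    then show ?thesis
      using open_frame_well_below_iff opens_box by blast
  qed
  moreover have "a \<le> box (c 0)"
    using box_mono[OF c(1)] assms(1) by (simp add: opens_def)
  moreover have "box (c 1) \<le> b"
    using box_le c(2) by (rule order_trans)
  ultimately show "frame_completely_below (open_frame box) a b"
    unfolding frame_completely_below_def open_frame_simps using opens_box
    by (intro exI[of _ "\<lambda>p. box (c p)"]) auto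
qed

subsection \<open>Completely regular ideals\<close>

text \<open>The ideals of \<open>beta_frame\<close> in terms of the operations of the algebra;
  membership of \<open>bot\<close> stands for nonemptiness.\<close>

definition cr_ideals :: "'a set set" where
  "cr_ideals = {I. I \<subseteq> opens box \<and> bot \<in> I \<and> (\<forall>a\<in>I. \<forall>b\<in>I. sup a b \<in> I) \<and>
     (\<forall>a\<in>I. \<forall>b\<in>opens box. b \<le> a \<longrightarrow> b \<in> I) \<and> (\<forall>a\<in>I. \<exists>b\<in>I. a \<prec>\<prec> b)}"

lemma cr_idealsI:
  assumes "I \<subseteq> opens box" "bot \<in> I" "\<And>a b. a \<in> I \<Longrightarrow> b \<in> I \<Longrightarrow> sup a b \<in> I"
    "\<And>a b. a \<in> I \<Longrightarrow> b \<in> opens box \<Longrightarrow> b \<le> a \<Longrightarrow> b \<in> I" "\<And>a. a \<in> I \<Longrightarrow> \<exists>b\<in>I. a \<prec>\<prec> b"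
  shows "I \<in> cr_ideals"
  using assms unfolding cr_ideals_def by simp

lemma cr_idealsD:
  assumes "I \<in> cr_ideals"
  shows "I \<subseteq> opens box" "bot \<in> I" "\<And>a b. a \<in> I \<Longrightarrow> b \<in> I \<Longrightarrow> sup a b \<in> I"
    "\<And>a b. a \<in> I \<Longrightarrow> b \<in> opens box \<Longrightarrow> b \<le> a \<Longrightarrow> b \<in> I" "\<And>a. a \<in> I \<Longrightarrow> \<exists>b\<in>I. a \<prec>\<prec> b"
  using assms unfolding cr_ideals_def by simp_all

lemma is_completely_regular_ideal_iff:
  "is_completely_regular_ideal (open_frame box) I \<longleftrightarrow> I \<in> cr_ideals"
proof
  assume "is_completely_regular_ideal (open_frame box) I"
  then have ideal: "I \<subseteq> opens box" "I \<noteq> {}" "\<forall>a\<in>I. \<forall>b\<in>I. a \<squnion>\<^bsub>open_frame box\<^esub> b \<in> I"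
      "\<forall>a\<in>I. \<forall>b\<in>opens box. b \<le> a \<longrightarrow> b \<in> I"
    and regular: "\<forall>a\<in>I. \<exists>b\<in>I. frame_completely_below (open_frame box) a b"
    unfolding is_completely_regular_ideal_def is_ideal_def open_frame_simps by simp_all
  show "I \<in> cr_ideals"
  proof (rule cr_idealsI)
    obtain a where "a \<in> I"
      using ideal(2) by blast
    then show "bot \<in> I"
      using ideal(4) opens_bot by simp
    show "sup a b \<in> I" if "a \<in> I" "b \<in> I" for a b
      using ideal(1,3) that open_frame_join[of a b] by (metis subsetD)
    show "\<exists>b\<in>I. a \<prec>\<prec> b" if "a \<in> I" for a
      using regular ideal(1) that open_frame_completely_below_iff by (metis subsetD)
  qed (use ideal in simp_all)
next
  assume I: "I \<in> cr_ideals"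
  have join: "a \<squnion>\<^bsub>open_frame box\<^esub> b \<in> I" if "a \<in> I" "b \<in> I" for a b
    using cr_idealsD(1,3)[OF I] that open_frame_join[of a b] by (metis subsetD)
  have regular: "\<exists>b\<in>I. frame_completely_below (open_frame box) a b" if "a \<in> I" for a
    using cr_idealsD(1,5)[OF I] that open_frame_completely_below_iff by (metis subsetD)
  show "is_completely_regular_ideal (open_frame box) I"
    unfolding is_completely_regular_ideal_def is_ideal_def open_frame_simps
  proof (intro conjI ballI impI)
    show "I \<noteq> {}"
      using cr_idealsD(2)[OF I] by auto
    show "b \<in> I" if "a \<in> I" "b \<in> opens box" "b \<le> a" for a b
      using that by (rule cr_idealsD(4)[OF I])
  qed (rule cr_idealsD(1)[OF I] join regular; assumption?)+
qed

lemma beta_frame_eq: "beta_frame (open_frame box) = \<lparr>carrier = cr_ideals, eq = (=), le = (\<subseteq>)\<rparr>"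
  by (simp add: beta_frame_def is_completely_regular_ideal_iff)

section \<open>The frame of completely regular ideals\<close>

lemma cr_ideals_Sup:
  assumes "I \<in> cr_ideals" "finite A" "A \<subseteq> I"
  shows "Sup A \<in> I"
  using assms(2,3) by (induction rule: finite_induct) (use cr_idealsD[OF assms(1)] in auto)

lemma cr_ideals_Int:
  assumes I: "I \<in> cr_ideals" and J: "J \<in> cr_ideals"
  shows "I \<inter> J \<in> cr_ideals"
proof (rule cr_idealsI)
  fix a
  assume a: "a \<in> I \<inter> J"
  then obtain b c where b: "b \<in> I" "a \<prec>\<prec> b" and c: "c \<in> J" "a \<prec>\<prec> c"
    using cr_idealsD(5)[OF I, of a] cr_idealsD(5)[OF J, of a] by auto
  have "inf b c \<in> opens box"
    using opens_inf b(1) c(1) cr_idealsD(1)[OF I] cr_idealsD(1)[OF J] by (meson subsetD)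
  then have "inf b c \<in> I \<inter> J"
    using cr_idealsD(4)[OF I b(1)] cr_idealsD(4)[OF J c(1)] by simp
  moreover have "a \<prec>\<prec> inf b c"
    using completely_below_inf[OF b(2) c(2)] by simp
  ultimately show "\<exists>b\<in>I \<inter> J. a \<prec>\<prec> b"
    by blast
qed (use cr_idealsD[OF I] cr_idealsD[OF J] in auto)

text \<open>The ideal generated by the union. The empty \<open>A\<close> is allowed, so that the
  empty join is the zero ideal.\<close>

definition cr_ideal_join :: "'a set set \<Rightarrow> 'a set" where
  "cr_ideal_join S = {u \<in> opens box. \<exists>A. finite A \<and> A \<subseteq> \<Union>S \<and> u \<le> Sup A}"

lemma cr_ideal_join_in_cr_ideals:
  assumes S: "S \<subseteq> cr_ideals"
  shows "cr_ideal_join S \<in> cr_ideals"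
proof (rule cr_idealsI)
  show "bot \<in> cr_ideal_join S"
    unfolding cr_ideal_join_def using opens_bot by (auto intro!: exI[of _ "{}"])
next
  fix a b
  assume "a \<in> cr_ideal_join S" "b \<in> cr_ideal_join S"
  then obtain A B where AB: "finite A" "A \<subseteq> \<Union>S" "a \<le> Sup A" "finite B" "B \<subseteq> \<Union>S" "b \<le> Sup B"
    and "a \<in> opens box" "b \<in> opens box"
    unfolding cr_ideal_join_def by blast
  then have "finite (A \<union> B)" "A \<union> B \<subseteq> \<Union>S" "sup a b \<le> Sup (A \<union> B)"
    unfolding Sup_union_distrib by (auto intro: le_supI1 le_supI2)
  with opens_sup[OF \<open>a \<in> opens box\<close> \<open>b \<in> opens box\<close>] show "sup a b \<in> cr_ideal_join S"
    unfolding cr_ideal_join_def by blast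
next
  fix a b
  assume "a \<in> cr_ideal_join S" "b \<in> opens box" "b \<le> a"
  then show "b \<in> cr_ideal_join S"
    unfolding cr_ideal_join_def by (auto intro: order_trans)
next
  fix a
  assume "a \<in> cr_ideal_join S"
  then obtain A where A: "finite A" "A \<subseteq> \<Union>S" "a \<le> Sup A"
    unfolding cr_ideal_join_def by blast
  \<comment> \<open>Each member of \<open>A\<close> has an element completely above it within its
    own ideal, and \<open>\<prec>\<prec>\<close> is stable under finite joins; so the generated
    ideal is again completely regular.\<close>
  have "\<exists>B. finite B \<and> B \<subseteq> \<Union>S \<and> Sup A \<prec>\<prec> Sup B"
    using A(1,2)
  proof (induction rule: finite_induct)
    case empty
    then show ?case
      using completely_below_bot by (auto intro!: exI[of _ "{}"])
  next
    case (insert x A)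
    then obtain B where B: "finite B" "B \<subseteq> \<Union>S" "Sup A \<prec>\<prec> Sup B"
      by blast
    obtain I where "I \<in> S" "x \<in> I"
      using insert.prems by blast
    then obtain y where y: "y \<in> I" "x \<prec>\<prec> y"
      using S cr_idealsD(5)[of I x] by blast
    have "Sup (insert x A) \<prec>\<prec> Sup (insert y B)"
      using completely_below_sup[OF y(2) B(3)] by simp
    with B y \<open>I \<in> S\<close> show ?case
      by (intro exI[of _ "insert y B"]) auto
  qed
  then obtain B where B: "finite B" "B \<subseteq> \<Union>S" "Sup A \<prec>\<prec> Sup B"
    by blast
  have "B \<subseteq> opens box"
    using B(2) S cr_idealsD(1) by blast
  then have "Sup B \<in> cr_ideal_join S"
    unfolding cr_ideal_join_def using B opens_Sup by blast
  moreover have "a \<prec>\<prec> Sup B"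
    using completely_below_mono[OF A(3) B(3) order_refl] .
  ultimately show "\<exists>b\<in>cr_ideal_join S. a \<prec>\<prec> b"
    by blast
qed (simp add: cr_ideal_join_def)

lemma cr_ideal_join_upper:
  assumes "S \<subseteq> cr_ideals" "I \<in> S"
  shows "I \<subseteq> cr_ideal_join S"
proof
  fix u
  assume "u \<in> I"
  moreover from this have "u \<in> opens box"
    using assms cr_idealsD(1) by blast
  ultimately show "u \<in> cr_ideal_join S"
    unfolding cr_ideal_join_def using assms(2) by (auto intro!: exI[of _ "{u}"])
qed

lemma cr_ideal_join_least:
  assumes K: "K \<in> cr_ideals" and "\<And>I. I \<in> S \<Longrightarrow> I \<subseteq> K"
  shows "cr_ideal_join S \<subseteq> K"
proof
  fix u
  assume "u \<in> cr_ideal_join S"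
  then obtain A where A: "finite A" "A \<subseteq> \<Union>S" "u \<le> Sup A" and "u \<in> opens box"
    unfolding cr_ideal_join_def by blast
  have "A \<subseteq> K"
    using A(2) assms(2) by blast
  from cr_ideals_Sup[OF K A(1) this] show "u \<in> K"
    using cr_idealsD(4)[OF K] A(3) \<open>u \<in> opens box\<close> by blast
qed

lemma least_cr_ideal_join:
  assumes "S \<subseteq> cr_ideals"
  shows "least (beta_frame (open_frame box)) (cr_ideal_join S) (Upper (beta_frame (open_frame box)) S)"
  unfolding beta_frame_eq
  by (rule least_Upper_classI)
    (rule cr_ideal_join_in_cr_ideals cr_ideal_join_upper cr_ideal_join_least assms; assumption?)+

text \<open>Finite distributivity is enough: if \<open>u \<le> Sup A\<close>, then \<open>u\<close>
  is covered by the elements \<open>inf u a\<close>, each of which lies in \<open>I\<close>, being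
  below \<open>u\<close>, and in the ideal that contributed \<open>a\<close>.\<close>

lemma cr_ideal_join_Int:
  assumes I: "I \<in> cr_ideals" and S: "S \<subseteq> cr_ideals"
  shows "I \<inter> cr_ideal_join S = cr_ideal_join ((\<inter>) I ` S)"
proof
  show "I \<inter> cr_ideal_join S \<subseteq> cr_ideal_join ((\<inter>) I ` S)"
  proof
    fix u
    assume u: "u \<in> I \<inter> cr_ideal_join S"
    then obtain A where A: "finite A" "A \<subseteq> \<Union>S" "u \<le> Sup A" and "u \<in> opens box"
      unfolding cr_ideal_join_def by blast
    have "inf u ` A \<subseteq> \<Union>((\<inter>) I ` S)"
    proof
      fix x
      assume "x \<in> inf u ` A"
      then obtain a J where a: "x = inf u a" "a \<in> J" "J \<in> S"
        using A(2) by blast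
      then have J: "J \<in> cr_ideals"
        using S by blast
      have "x \<in> opens box"
        using a J \<open>u \<in> opens box\<close> cr_idealsD(1)[OF J] opens_inf by blast
      then have "x \<in> I" "x \<in> J"
        using a u cr_idealsD(4)[OF I, of u x] cr_idealsD(4)[OF J, of a x] by auto
      with a show "x \<in> \<Union>((\<inter>) I ` S)"
        by blast
    qed
    moreover have "u \<le> Sup (inf u ` A)"
      using A(3) unfolding inf_Sup_finite[OF A(1), symmetric] by simp
    ultimately show "u \<in> cr_ideal_join ((\<inter>) I ` S)"
      unfolding cr_ideal_join_def using A(1) \<open>u \<in> opens box\<close> by blast
  qed
  have "I \<inter> cr_ideal_join S \<in> cr_ideals"
    by (intro cr_ideals_Int I cr_ideal_join_in_cr_ideals S)
  then show "cr_ideal_join ((\<inter>) I ` S) \<subseteq> I \<inter> cr_ideal_join S"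
    using cr_ideal_join_upper[OF S] by (intro cr_ideal_join_least) auto
qed

lemma frame_beta_frame: "frame (beta_frame (open_frame box))" (is "frame ?L")
proof -
  have po: "partial_order ?L"
    unfolding beta_frame_eq by (rule partial_order_class)
  have carrier: "carrier ?L = cr_ideals"
    by (simp add: beta_frame_eq)
  have Sup_eq: "\<Squnion>\<^bsub>?L\<^esub>S = cr_ideal_join S" if "S \<subseteq> cr_ideals" for S
    by (rule partial_order.sup_eqI[OF po least_cr_ideal_join[OF that]])
  have meet_eq: "I \<sqinter>\<^bsub>?L\<^esub> J = I \<inter> J" if "I \<in> cr_ideals" "J \<in> cr_ideals" for I J
    unfolding meet_def beta_frame_eq
    by (rule inf_class_eqI) (use that cr_ideals_Int in auto)
  have "complete_lattice ?L"
    by (rule partial_order.complete_lattice_if_sup_exists[OF po])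
      (use least_cr_ideal_join carrier in blast)
  moreover have "I \<sqinter>\<^bsub>?L\<^esub> \<Squnion>\<^bsub>?L\<^esub>S = \<Squnion>\<^bsub>?L\<^esub>((\<lambda>J. I \<sqinter>\<^bsub>?L\<^esub> J) ` S)"
    if I: "I \<in> cr_ideals" and S: "S \<subseteq> cr_ideals" for I S
  proof -
    have image: "(\<lambda>J. I \<sqinter>\<^bsub>?L\<^esub> J) ` S = (\<inter>) I ` S"
      using meet_eq[OF I] S by (intro image_cong) auto
    have closed: "(\<inter>) I ` S \<subseteq> cr_ideals"
      using I S cr_ideals_Int by blast
    show ?thesis
      unfolding image Sup_eq[OF S] Sup_eq[OF closed]
        meet_eq[OF I cr_ideal_join_in_cr_ideals[OF S]]
      by (rule cr_ideal_join_Int[OF I S])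
  qed
  ultimately show ?thesis
    by (intro frame.intro frame_axioms.intro) (simp_all add: carrier)
qed

subsection \<open>The isomorphism\<close>

abbreviation Z where "Z \<equiv> zero_elements box"

text \<open>The relation \<open>\<prec>\<prec>\<close> instead of \<open>\<le>\<close> leaves room
  for an interpolant, which is what complete regularity of the ideal asks for.\<close>

definition ideal_of :: "'a set set \<Rightarrow> 'a set" where
  "ideal_of C = {u \<in> opens box. \<exists>z\<in>Z. C \<subseteq> sigma Z z \<and> u \<prec>\<prec> - z}"

text \<open>For a completely regular ideal \<open>I\<close>, the zero-elements with complement in
  \<open>I\<close> form a filter of \<open>Z\<close>; this is the closed set that the filter cuts
  out.\<close>

definition closed_of :: "'a set \<Rightarrow> 'a set set" where
  "closed_of I = sigma_Inter Z {z \<in> Z. - z \<in> I}"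

lemmas zero_elements_sublattice = zero_elements_bot zero_elements_inf

lemma ideal_of_antimono: "C \<subseteq> D \<Longrightarrow> ideal_of D \<subseteq> ideal_of C"
  unfolding ideal_of_def by blast

lemma closed_of_antimono: "I \<subseteq> J \<Longrightarrow> closed_of J \<subseteq> closed_of I"
  unfolding closed_of_def sigma_Inter_def by blast

lemma ideal_of_in_cr_ideals:
  assumes C: "C \<subseteq> proper_filters Z"
  shows "ideal_of C \<in> cr_ideals"
proof (rule cr_idealsI)
  have "C \<subseteq> sigma Z top_class.top"
    using C sigma_top[OF zero_elements_bot] by simp
  then show "bot \<in> ideal_of C"
    unfolding ideal_of_def using opens_bot zero_elements_top completely_below_bot by blast
next
  fix a b
  assume "a \<in> ideal_of C" "b \<in> ideal_of C"
  then obtain x y where x: "x \<in> Z" "C \<subseteq> sigma Z x" "a \<prec>\<prec> - x"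
    and y: "y \<in> Z" "C \<subseteq> sigma Z y" "b \<prec>\<prec> - y" and ab: "a \<in> opens box" "b \<in> opens box"
    unfolding ideal_of_def by blast
  \<comment> \<open>Joins in the ideal correspond to meets of zero-elements, so closure under joins
    rests on \<open>sigma_inf\<close>.\<close>
  have "C \<subseteq> sigma Z (inf x y)"
    using x(2) y(2) sigma_inf[OF zero_elements_sublattice y(1)] by blast
  moreover have "sup a b \<prec>\<prec> - inf x y"
    using completely_below_sup[OF x(3) y(3)] by simp
  ultimately show "sup a b \<in> ideal_of C"
    unfolding ideal_of_def using opens_sup[OF ab] zero_elements_inf[OF x(1) y(1)] by blast
next
  fix a b
  assume "a \<in> ideal_of C" "b \<in> opens box" "b \<le> a"
  then show "b \<in> ideal_of C"
    unfolding ideal_of_def using completely_below_mono[OF _ _ order_refl] by blast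
next
  fix a
  assume "a \<in> ideal_of C"
  then obtain z where z: "z \<in> Z" "C \<subseteq> sigma Z z" "a \<prec>\<prec> - z"
    unfolding ideal_of_def by blast
  obtain w where "w \<in> opens box" "a \<prec>\<prec> w" "w \<prec>\<prec> - z"
    using completely_below_interpolate[OF z(3)] by blast
  with z show "\<exists>b\<in>ideal_of C. a \<prec>\<prec> b"
    unfolding ideal_of_def by blast
qed (simp add: ideal_of_def)

text \<open>If some extension of \<open>x\<close> contained \<open>b\<close> disjoint from
  \<open>z\<close>, then separation and interpolation would give a zero-element \<open>w\<close>
  with \<open>z \<prec>\<prec> w\<close> that is still disjoint from \<open>b\<close>, against
  \<open>x \<in> sigma Z w\<close>.\<close>

lemma sigmaI_completely_above:
  assumes z: "z \<in> Z" and x: "x \<in> proper_filters Z"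
    and above: "\<And>w. w \<in> Z \<Longrightarrow> z \<prec>\<prec> w \<Longrightarrow> x \<in> sigma Z w"
  shows "x \<in> sigma Z z"
proof -
  have "inf z b \<noteq> bot" if y: "y \<in> proper_filters Z" "x \<subseteq> y" "b \<in> y" for y b
  proof
    assume "inf z b = bot"
    have "b \<in> Z"
      using y by (auto simp: proper_filters_def is_filter_def)
    obtain w where w: "w \<in> Z" "z \<prec>\<prec> w" "w \<prec>\<prec> - b"
      using zero_element_interpolate[OF completely_below_compl_disjoint[OF z \<open>b \<in> Z\<close> \<open>inf z b = bot\<close>]]
      by blast
    have "inf w b \<noteq> bot"
      using above[OF w(1,2)] y by (auto simp: sigma_def)
    moreover have "inf w b = bot"
      using completely_below_le[OF w(3)] by (simp add: inf_shunt)
    ultimately show False ..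
  qed
  with x show ?thesis
    by (simp add: sigma_def)
qed

text \<open>Going to the ideal and back replaces \<open>sigma Z z\<close> by the sets
  \<open>sigma Z w\<close> with \<open>z \<prec>\<prec> w\<close>. These are larger individually,
  but together they determine \<open>sigma Z z\<close> by
  \<open>sigmaI_completely_above\<close>.\<close>

lemma closed_of_ideal_of:
  assumes T: "T \<subseteq> Z"
  shows "closed_of (ideal_of (sigma_Inter Z T)) = sigma_Inter Z T" (is "closed_of (ideal_of ?C) = ?C")
proof
  show "?C \<subseteq> closed_of (ideal_of ?C)"
  proof
    fix x
    assume x: "x \<in> ?C"
    have "x \<in> sigma Z z" if z: "z \<in> Z" "- z \<in> ideal_of ?C" for z
    proof -
      obtain w where w: "w \<in> Z" "?C \<subseteq> sigma Z w" "- z \<prec>\<prec> - w"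
        using z(2) unfolding ideal_of_def by blast
      have "w \<le> z"
        using completely_below_le[OF w(3)] by simp
      then show ?thesis
        using x w(2) sigma_mono by blast
    qed
    with x show "x \<in> closed_of (ideal_of ?C)"
      by (simp add: closed_of_def sigma_Inter_def)
  qed
  show "closed_of (ideal_of ?C) \<subseteq> ?C"
  proof
    fix x
    assume x: "x \<in> closed_of (ideal_of ?C)"
    then have X: "x \<in> proper_filters Z"
      by (simp add: closed_of_def sigma_Inter_def)
    have "x \<in> sigma Z z" if "z \<in> T" for z
    proof (rule sigmaI_completely_above)
      show "z \<in> Z"
        using that T by blast
      fix w
      assume w: "w \<in> Z" "z \<prec>\<prec> w"
      have "?C \<subseteq> sigma Z z"
        using that by (auto simp: sigma_Inter_def)
      then have "- w \<in> ideal_of ?C"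
        unfolding ideal_of_def
        using \<open>z \<in> Z\<close> compl_zero_elements_opens[OF w(1)] completely_below_compl[OF w(2)] by blast
      with x w(1) show "x \<in> sigma Z w"
        by (simp add: closed_of_def sigma_Inter_def)
    qed (rule X)
    with X show "x \<in> ?C"
      by (simp add: sigma_Inter_def)
  qed
qed

text \<open>The inclusion from left to right is a compactness argument: a zero-element disjoint from
  \<open>closed_of I\<close> is already disjoint from a single zero-element with complement in \<open>I\<close>, since
  otherwise the two generate a proper filter.\<close>
lemma ideal_of_closed_of:
  assumes I: "I \<in> cr_ideals"
  shows "ideal_of (closed_of I) = I"
proof
  show "I \<subseteq> ideal_of (closed_of I)"
  proof
    fix u
    assume u: "u \<in> I"
    then obtain v where v: "v \<in> I" "u \<prec>\<prec> v"
      using cr_idealsD(5)[OF I] by blast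
    then obtain w where w: "u \<prec>\<prec> w" "w \<prec>\<prec> v"
      using completely_below_interpolate by blast
    \<comment> \<open>The chain \<open>u \<prec>\<prec> w \<prec>\<prec> v\<close> is used twice:
      \<open>- z \<le> v\<close> puts \<open>- z\<close> into \<open>I\<close>, and
      \<open>w \<le> - z\<close> gives \<open>u \<prec>\<prec> - z\<close>.\<close>
    obtain z where z: "z \<in> Z" "- v \<le> z" "z \<le> - w"
      using zero_element_between[OF completely_below_compl[OF w(2)]] by blast
    have "- z \<le> v"
      using z(2) by (rule compl_le_swap2)
    then have "- z \<in> I"
      using cr_idealsD(4)[OF I v(1)] compl_zero_elements_opens[OF z(1)] by blast
    then have "closed_of I \<subseteq> sigma Z z"
      using z(1) by (auto simp: closed_of_def sigma_Inter_def)
    moreover have "w \<le> - z"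
      using z(3) by (rule compl_le_swap1)
    then have "u \<prec>\<prec> - z"
      by (rule completely_below_mono[OF order_refl w(1)])
    moreover have "u \<in> opens box"
      using u cr_idealsD(1)[OF I] by blast
    ultimately show "u \<in> ideal_of (closed_of I)"
      unfolding ideal_of_def using z(1) by blast
  qed
  show "ideal_of (closed_of I) \<subseteq> I"
  proof
    fix u
    assume "u \<in> ideal_of (closed_of I)"
    then obtain z where z: "z \<in> Z" "closed_of I \<subseteq> sigma Z z" "u \<prec>\<prec> - z" and "u \<in> opens box"
      unfolding ideal_of_def by blast
    \<comment> \<open>Filters of \<open>Z\<close> can only be extended by zero-elements, so the open
      element \<open>u\<close> is enlarged to a zero-element that is still disjoint from
      \<open>z\<close>.\<close>
    obtain b where b: "b \<in> Z" "u \<le> b" "b \<le> - z"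
      using zero_element_between[OF z(3)] by blast
    define F where "F = {z \<in> Z. - z \<in> I}"
    have F: "is_filter Z F"
      unfolding is_filter_def F_def
      using zero_elements_top zero_elements_inf cr_idealsD[OF I]
      by (auto simp: compl_zero_elements_opens)
    have "\<exists>w\<in>F. inf b w = bot"
    proof (rule ccontr)
      assume disjoint: "\<not> (\<exists>w\<in>F. inf b w = bot)"
      then have "bot \<notin> F"
        by auto
      then have "F \<in> proper_filters Z"
        using F proper_filters_iff[OF zero_elements_bot] by blast
      then obtain G where G: "G \<in> proper_filters Z" "F \<subseteq> G" "b \<in> G"
        using proper_filters_extend[OF zero_elements_sublattice _ b(1)] disjoint by metis
      have "G \<in> sigma Z w" if "w \<in> F" for w
        using mem_sigma[OF zero_elements_bot G(1)] G(2) that by blast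
      then have "G \<in> closed_of I"
        using G(1) by (simp add: closed_of_def sigma_Inter_def F_def)
      then have "inf z b \<noteq> bot"
        using z(2) G by (auto simp: sigma_def)
      then show False
        using b(3) by (metis inf_shunt inf.commute)
    qed
    then obtain w where w: "w \<in> F" "inf b w = bot"
      by blast
    then have "u \<le> - w"
      using b(2) by (simp add: inf_shunt)
    moreover have "- w \<in> I"
      using w(1) by (simp add: F_def)
    ultimately show "u \<in> I"
      using cr_idealsD(4)[OF I] \<open>u \<in> opens box\<close> by blast
  qed
qed

theorem frame_isomorphic_beta_frame:
  "frame_isomorphic (stone_cech_open_frame box) (beta_frame (open_frame box))"
proof (rule frame_isomorphicI)
  let ?X = "proper_filters Z"
  let ?U = "\<lambda>T. upset_complement ?X (sigma_Inter Z T)"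
  have L: "stone_cech_open_frame box = \<lparr>carrier = ?U ` Pow Z, eq = (=), le = (\<subseteq>)\<rparr>"
    unfolding stone_cech_open_frame_def extension_opens_eq
    by (simp add: regular_open_algebra_def)
  \<comment> \<open>Complementation and \<open>ideal_of\<close> both reverse the order, so
    \<open>h\<close> preserves it; the same holds for \<open>g\<close>. Monotonicity in both
    directions, with \<open>g\<close> undoing \<open>h\<close>, gives the order equivalence needed
    for transport.\<close>
  define h where "h U = ideal_of (upset_complement ?X U)" for U
  define g where "g I = upset_complement ?X (closed_of I)" for I
  have compl: "upset_complement ?X (?U T) = sigma_Inter Z T" for T
    by (rule upset_complement_involutive[OF sigma_Inter_regular_open])
  have gh: "g (h U) = U" if U: "U \<in> ?U ` Pow Z" for U
  proof -
    obtain T where "T \<subseteq> Z" "U = ?U T"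
      using U by blast
    then show ?thesis
      by (simp add: g_def h_def compl closed_of_ideal_of)
  qed
  have h_mono: "h U \<subseteq> h V" if "U \<subseteq> V" for U V
    unfolding h_def using that by (intro ideal_of_antimono upset_complement_antimono)
  have g_mono: "g I \<subseteq> g J" if "I \<subseteq> J" for I J
    unfolding g_def using that by (intro closed_of_antimono upset_complement_antimono)
  show "bij_betw h (carrier (stone_cech_open_frame box)) (carrier (beta_frame (open_frame box)))"
  proof (rule bij_betw_byWitness[where f' = g])
    show "\<forall>I\<in>carrier (beta_frame (open_frame box)). h (g I) = I"
    proof
      fix I
      assume "I \<in> carrier (beta_frame (open_frame box))"
      then have "I \<in> cr_ideals"
        by (simp add: beta_frame_eq)
      then show "h (g I) = I"
        unfolding h_def g_def closed_of_def compl
        by (rule ideal_of_closed_of[unfolded closed_of_def])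
    qed
    show "h ` carrier (stone_cech_open_frame box) \<subseteq> carrier (beta_frame (open_frame box))"
      unfolding beta_frame_eq h_def
      by (auto intro!: ideal_of_in_cr_ideals simp: upset_complement_def)
    show "g ` carrier (beta_frame (open_frame box)) \<subseteq> carrier (stone_cech_open_frame box)"
      unfolding L g_def closed_of_def by auto
  qed (simp add: L gh)
  show "U \<sqsubseteq>\<^bsub>stone_cech_open_frame box\<^esub> V \<longleftrightarrow> h U \<sqsubseteq>\<^bsub>beta_frame (open_frame box)\<^esub> h V"
    if "U \<in> carrier (stone_cech_open_frame box)" "V \<in> carrier (stone_cech_open_frame box)" for U V
  proof -
    have "U \<in> ?U ` Pow Z" "V \<in> ?U ` Pow Z"
      using that by (simp_all only: L partial_object.simps)
    then have "U \<subseteq> V \<longleftrightarrow> h U \<subseteq> h V"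
      using h_mono g_mono gh by metis
    then show ?thesis
      by (simp add: L beta_frame_eq)
  qed
  show "partial_order (stone_cech_open_frame box)"
    unfolding L by (rule partial_order_class)
qed (rule frame_beta_frame)

end

theorem theorem4p25:
  fixes box :: "'a :: {boolean_algebra, complete_lattice} \<Rightarrow> 'a"
  assumes "completely_regular_mt_algebra box"
  shows "frame_isomorphic (stone_cech_open_frame box) (beta_frame (open_frame box))"
proof -
  interpret completely_regular_mt_algebra box
    by fact
  show ?thesis
    by (rule frame_isomorphic_beta_frame)
qed

end
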